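(* Let $(S_1,v_1),\ldots,(S_k,v_k)$ be immersed submanifolds $S_i\subset\mathbb{R}^{n+1}$ with $\dim S_i=k$, equipped with unit tangent vector fields $v_i\in\Gamma(TS_i)$, such that for all $i,j$: $\Phi_{v_i}(S_i)=\Phi_{v_j}(S_j)$; $\Phi_{v_i}:S_i\to\Phi_{v_i}(S_i)$ is a diffeomorphism; and $\Phi_{v_i}(S_i)$ is isotropic. Define $\mu_{ij}:S_i\to\mathbb{R}$, the signed distance from $S_i$ to $S_j$, by $$\mu_{ij}(q)=\big\langle q-(\Phi_{v_j}^{-1}\circ\Phi_{v_i})(q),\,v_i(q)\big\rangle,\qquad i,j\in\{1,\ldots,k\}.$$ Assume $\mu_{ij}$ is nowhere $0$ for $i\neq j$, and define $E_{ij},V_{ij}\in\Gamma(TS_i)$ by $$E_{ij}:=V_{ij}-\langle V_{ij},v_i\rangle v_i,\qquad V_{ij}:=\mathrm{d}(\Phi_{v_i}^{-1}\circ\Phi_{v_j})(v_j).$$ Then: (a) If $\mathcal{M}\subset S_1$ is an integral manifold of $v_1^\perp$ and $p\in\mathcal{M}$, then $\{E_{1j}(p)\}_{j=2}^k$ are principal directions of $\mathcal{M}$ at $p$ with distinct principal values $\{1/\mu_{1j}(p)\}_{j=2}^k$. (b) The vector fields $\{E_{1j}\}_{j=2}^k$ are an orthogonal frame of $v_1^\perp$, and the Ricci curvature tensor of $S_1$ satisfies $$\mathrm{Ric}(v_1,v_1)=\sum_{j=2}^kK(v_1,E_{1j})=\sum_{j=2}^k\frac{\mathrm{d}\mu_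{1j}(v_1)-1}{(\mu_{1j})^2}.$$
   Context: "Smooth" means $C^2$; the submanifolds $S_i$ are $C^2$-smooth. $\langle\cdot,\cdot\rangle$ is the Euclidean inner product on $\mathbb{R}^{n+1}$. A subset $\mathcal N$ of a manifold $\mathcal M$ is immersed if $\mathcal N$ itself is a smooth manifold and the inclusion is a smooth immersion. $S_1$ carries the induced metric with Levi-Civita connection $\nabla$, sectional curvature $K$ (with $K(A,B)$ the curvature of the plane spanned by $A,B$) and Ricci tensor $\mathrm{Ric}$. $v_1^\perp$ is the distribution $p\mapsto\{X\in T_pS_1:\langle X,v_1(p)\rangle=0\}$ on $S_1$. An integral manifold $\mathcal{M}$ of $v_1^\perp$ is a hypersurface in $S_1$ with unit normal $v_1|_{\mathcal M}$; its shape operator is $X\mapsto\nabla_Xv_1$, and principal directions and values are its eigenvectors and eigenvalues. Identify $T\mathbb{S}^n=\{(\xi,\eta)\in\mathbb{R}^{n+1}\times\mathbb{R}^{n+1}: |\xi|=1,\ \langle\xi,\eta\rangle=0\}$, where $(\xi,\eta)$ corresponds to the oriented line $\{\eta+t\xi\}$. For a unit vector field $v$ on $S$, $\Phi_v:S\to T\mathbb{S}^n$ is $\Phi_v(p)=(v(p),p-\langle v(p),p\rangle v(p))$. Let $g$ be the round metric on $\mathbb{S}^n$ and $\pi:T\mathbb{S}^n\to\mathbb{S}^n$ the projection; $\theta_{(\xi,\eta)}(X)=g_\xi(\mathrm{d}\pi(X),\eta)$ and $\Omega=-\mathrm{d}\theta$. A submanifold $\Gamma\subseteq T\mathbb{S}^n$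 is isotropic if $\Omega|_\Gamma=0$. *)

theory Defs
  imports "HOL-Analysis.Analysis"
begin

section \<open>Maps of class C1 and C2 between normed spaces\<close>

definition C1_on :: "'a::real_normed_vector set \<Rightarrow> ('a \<Rightarrow> 'b::real_normed_vector) \<Rightarrow> bool" where
  "C1_on U f \<longleftrightarrow>
     (\<exists>f'. (\<forall>x\<in>U. (f has_derivative blinfun_apply (f' x)) (at x)) \<and> continuous_on U f')"

definition C2_on :: "'a::real_normed_vector set \<Rightarrow> ('a \<Rightarrow> 'b::real_normed_vector) \<Rightarrow> bool" where
  "C2_on U f \<longleftrightarrow>
     (\<exists>f'. (\<forall>x\<in>U. (f has_derivative blinfun_apply (f' x)) (at x)) \<and> C1_on U f')"


section \<open>Immersed submanifolds\<close>

text \<open>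
  A manifold structure on a set is an atlas of local parametrizations \<open>(U, \<phi>)\<close>: \<open>U\<close> is
  an open subset of the model space \<open>'b\<close>, so the dimension is \<open>DIM('b)\<close>, and \<open>\<phi>\<close> maps \<open>U\<close>
  into the set. The manifold topology is the one generated by the parametrizations; it may be
  strictly finer than the subspace topology.
\<close>

type_synonym ('b, 'm) atlas = "('b set \<times> ('b \<Rightarrow> 'm)) set"

text \<open>The openness condition expresses continuity with respect to the manifold topologies.\<close>

definition C2_map ::
  "('b::real_normed_vector, 'm) atlas \<Rightarrow> ('c::real_normed_vector, 'p) atlas \<Rightarrow> ('m \<Rightarrow> 'p) \<Rightarrow> bool"
where
  "C2_map A B f \<longleftrightarrow>
     (\<forall>(U, \<phi>)\<in>A. \<forall>(V, \<psi>)\<in>B.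
        let W = {u \<in> U. f (\<phi> u) \<in> \<psi> ` V}
        in open W \<and> C2_on W (inv_into V \<psi> \<circ> f \<circ> \<phi>))"

definition diffeomorphism ::
  "('b::real_normed_vector, 'm) atlas \<Rightarrow> 'm set \<Rightarrow> ('c::real_normed_vector, 'p) atlas \<Rightarrow> 'p set
    \<Rightarrow> ('m \<Rightarrow> 'p) \<Rightarrow> bool"
where
  "diffeomorphism A M B N f \<longleftrightarrow>
     bij_betw f M N \<and> C2_map A B f \<and> C2_map B A (inv_into M f)"

text \<open>
  \<open>C2_map A A (\<lambda>p. p)\<close> says that the transition maps are of class C2 between open sets. The
  inclusion is then a C2 immersion because every \<open>\<phi>\<close> is one. The countable subatlas is second
  countability; the Hausdorff property is automatic, the inclusion being continuous and injective.
\<close>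

definition immersed_submanifold ::
  "('b::euclidean_space, 'm::euclidean_space) atlas \<Rightarrow> 'm set \<Rightarrow> bool"
where
  "immersed_submanifold A M \<longleftrightarrow>
     M = (\<Union>(U, \<phi>)\<in>A. \<phi> ` U) \<and>
     (\<exists>A'\<subseteq>A. countable A' \<and> M = (\<Union>(U, \<phi>)\<in>A'. \<phi> ` U)) \<and>
     (\<forall>(U, \<phi>)\<in>A. open U \<and> inj_on \<phi> U \<and> C2_on U \<phi> \<and>
        (\<forall>u\<in>U. inj (frechet_derivative \<phi> (at u)))) \<and>
     C2_map A A (\<lambda>p. p)"

definition C1_fun ::
  "('b::real_normed_vector, 'm) atlas \<Rightarrow> ('m \<Rightarrow> 'c::real_normed_vector) \<Rightarrow> bool" where
  "C1_fun A f \<longleftrightarrow> (\<forall>(U, \<phi>)\<in>A. C1_on U (f \<circ> \<phi>))"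

definition C2_fun ::
  "('b::real_normed_vector, 'm) atlas \<Rightarrow> ('m \<Rightarrow> 'c::real_normed_vector) \<Rightarrow> bool" where
  "C2_fun A f \<longleftrightarrow> (\<forall>(U, \<phi>)\<in>A. C2_on U (f \<circ> \<phi>))"

definition tangent_space ::
  "('b::real_normed_vector, 'm::real_normed_vector) atlas \<Rightarrow> 'm \<Rightarrow> 'm set" where
  "tangent_space A p =
     {frechet_derivative \<phi> (at u) w | U \<phi> u w. (U, \<phi>) \<in> A \<and> u \<in> U \<and> \<phi> u = p}"

text \<open>
  The differential \<open>df\<^sub>p(X)\<close> for \<open>X\<close> tangent at \<open>p\<close>. The value described is independent of
  the parametrization by the chain rule.
\<close>

definition mderiv ::
  "('b::real_normed_vector, 'm::real_normed_vector) atlas \<Rightarrow> ('m \<Rightarrow> 'c::real_normed_vector)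
    \<Rightarrow> 'm \<Rightarrow> 'm \<Rightarrow> 'c"
where
  "mderiv A f p X =
     (THE y. \<exists>U \<phi> u w. (U, \<phi>) \<in> A \<and> u \<in> U \<and> \<phi> u = p \<and>
        frechet_derivative \<phi> (at u) w = X \<and> frechet_derivative (f \<circ> \<phi>) (at u) w = y)"


section \<open>Riemannian geometry of the induced metric\<close>

definition tangential ::
  "('b::real_normed_vector, 'm::real_inner) atlas \<Rightarrow> 'm \<Rightarrow> 'm \<Rightarrow> 'm" where
  "tangential A p x =
     (THE y. y \<in> tangent_space A p \<and> (\<forall>z\<in>tangent_space A p. (x - y) \<bullet> z = 0))"

text \<open>The Levi-Civita connection of the induced metric, in its direct form for submanifolds of a
  Euclidean space: the tangential part of the ambient derivative.\<close>

definition nabla ::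
  "('b::real_normed_vector, 'm::real_inner) atlas \<Rightarrow> ('m \<Rightarrow> 'm) \<Rightarrow> ('m \<Rightarrow> 'm) \<Rightarrow> 'm \<Rightarrow> 'm" where
  "nabla A X Y p = tangential A p (mderiv A Y p (X p))"

text \<open>\<open>[X, Y] f = X (Y f) - Y (X f)\<close>, evaluated on the ambient coordinate functions \<open>f\<close>.\<close>

definition lie_bracket ::
  "('b::real_normed_vector, 'm::real_normed_vector) atlas \<Rightarrow> ('m \<Rightarrow> 'm) \<Rightarrow> ('m \<Rightarrow> 'm) \<Rightarrow> 'm \<Rightarrow> 'm"
where
  "lie_bracket A X Y p = mderiv A Y p (X p) - mderiv A X p (Y p)"

definition riemann ::
  "('b::real_normed_vector, 'm::real_inner) atlas
    \<Rightarrow> ('m \<Rightarrow> 'm) \<Rightarrow> ('m \<Rightarrow> 'm) \<Rightarrow> ('m \<Rightarrow> 'm) \<Rightarrow> 'm \<Rightarrow> 'm"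
where
  "riemann A X Y Z p =
     nabla A X (nabla A Y Z) p - nabla A Y (nabla A X Z) p - nabla A (lie_bracket A X Y) Z p"

text \<open>
  On a C2 submanifold, \<open>R(X, Y) Z\<close> makes sense for C1 fields \<open>X\<close>, \<open>Y\<close> and a field \<open>Z\<close> that is
  C2 as a map into the ambient space. This is why, of the equal expressions for the sectional
  curvature, the one that puts the first argument into the slot of \<open>Z\<close> is used.
\<close>

definition sectional_curvature ::
  "('b::real_normed_vector, 'm::real_inner) atlas \<Rightarrow> ('m \<Rightarrow> 'm) \<Rightarrow> ('m \<Rightarrow> 'm) \<Rightarrow> 'm \<Rightarrow> real"
where
  "sectional_curvature A X Y p =
     (riemann A Y X X p \<bullet> Y p) / ((X p \<bullet> X p) * (Y p \<bullet> Y p) - (X p \<bullet> Y p)\<^sup>2)"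

definition orthonormal_basis :: "'m::real_inner set \<Rightarrow> 'm set \<Rightarrow> bool" where
  "orthonormal_basis T B \<longleftrightarrow> pairwise orthogonal B \<and> (\<forall>b\<in>B. norm b = 1) \<and> span B = T"

text \<open>
  \<open>Ric(Y, Z)\<close> is the trace of \<open>x \<mapsto> R(x, Y) Z\<close> on the tangent space. The vector \<open>e\<close> is
  extended to the C1 vector field \<open>q \<mapsto> tangential A q e\<close>.
\<close>

definition ricci ::
  "('b::real_normed_vector, 'm::real_inner) atlas \<Rightarrow> ('m \<Rightarrow> 'm) \<Rightarrow> ('m \<Rightarrow> 'm) \<Rightarrow> 'm \<Rightarrow> real"
where
  "ricci A Y Z p =
     (\<Sum>e\<in>(SOME B. orthonormal_basis (tangent_space A p) B).
        riemann A (\<lambda>q. tangential A q e) Y Z p \<bullet> e)"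


section \<open>Unit vector fields and their orthogonal distributions\<close>

definition unit_vector_field ::
  "('b::real_normed_vector, 'm::real_inner) atlas \<Rightarrow> 'm set \<Rightarrow> ('m \<Rightarrow> 'm) \<Rightarrow> bool" where
  "unit_vector_field A M v \<longleftrightarrow>
     C2_fun A v \<and> (\<forall>p\<in>M. v p \<in> tangent_space A p \<and> norm (v p) = 1)"

definition perp ::
  "('b::real_normed_vector, 'm::real_inner) atlas \<Rightarrow> ('m \<Rightarrow> 'm) \<Rightarrow> 'm \<Rightarrow> 'm set" where
  "perp A v p = {X \<in> tangent_space A p. X \<bullet> v p = 0}"

text \<open>\<open>C2_map C A (\<lambda>p. p)\<close> makes \<open>N\<close> a submanifold of \<open>M\<close>, not only of the ambient space.\<close>

definition integral_manifold ::
  "('c::euclidean_space, 'm::euclidean_space) atlas \<Rightarrow> 'm set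
    \<Rightarrow> ('b::euclidean_space, 'm) atlas \<Rightarrow> 'm set \<Rightarrow> ('m \<Rightarrow> 'm set) \<Rightarrow> bool"
where
  "integral_manifold C N A M D \<longleftrightarrow>
     immersed_submanifold C N \<and> N \<subseteq> M \<and> C2_map C A (\<lambda>p. p) \<and>
     (\<forall>p\<in>N. tangent_space C p = D p)"

text \<open>The shape operator of a hypersurface of the manifold with atlas \<open>A\<close> and unit normal \<open>v\<close>.\<close>

definition shape_operator ::
  "('b::real_normed_vector, 'm::real_inner) atlas \<Rightarrow> ('m \<Rightarrow> 'm) \<Rightarrow> 'm \<Rightarrow> 'm \<Rightarrow> 'm" where
  "shape_operator A v p X = nabla A (\<lambda>_. X) v p"

definition principal_direction ::
  "('c::real_normed_vector, 'm::real_inner) atlas \<Rightarrow> ('b::real_normed_vector, 'm) atlas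
    \<Rightarrow> ('m \<Rightarrow> 'm) \<Rightarrow> 'm \<Rightarrow> 'm \<Rightarrow> real \<Rightarrow> bool"
where
  "principal_direction C A v p X c \<longleftrightarrow>
     X \<in> tangent_space C p \<and> X \<noteq> 0 \<and> shape_operator A v p X = c *\<^sub>R X"

definition orthogonal_frame ::
  "('b::real_normed_vector, 'm::real_inner) atlas \<Rightarrow> 'm set \<Rightarrow> ('m \<Rightarrow> 'm set)
    \<Rightarrow> 'i set \<Rightarrow> ('i \<Rightarrow> 'm \<Rightarrow> 'm) \<Rightarrow> bool"
where
  "orthogonal_frame A M D J F \<longleftrightarrow>
     (\<forall>j\<in>J. C1_fun A (F j)) \<and>
     (\<forall>p\<in>M. (\<forall>i\<in>J. \<forall>j\<in>J. i \<noteq> j \<longrightarrow> F i p \<bullet> F j p = 0) \<and>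
        inj_on (\<lambda>j. F j p) J \<and> independent ((\<lambda>j. F j p) ` J) \<and>
        span ((\<lambda>j. F j p) ` J) = D p)"


section \<open>The space of oriented lines\<close>

definition TSphere :: "('m::real_inner \<times> 'm) set" where
  "TSphere = {(\<xi>, \<eta>). norm \<xi> = 1 \<and> \<xi> \<bullet> \<eta> = 0}"

definition Phi :: "('m::real_inner \<Rightarrow> 'm) \<Rightarrow> 'm \<Rightarrow> 'm \<times> 'm" where
  "Phi v p = (v p, p - (v p \<bullet> p) *\<^sub>R v p)"

text \<open>
  The bundle projection is \<open>fst\<close>, and the round metric is the restriction of the inner product.
  The same formula defines a one-form on the whole product space. Exterior differentiation
  commutes with restriction, so \<open>\<Omega>\<close> restricted to a submanifold of \<open>TSphere\<close> may be computed
  from this extension.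
\<close>

definition theta :: "'m::real_inner \<times> 'm \<Rightarrow> 'm \<times> 'm \<Rightarrow> real" where
  "theta z X = fst X \<bullet> snd z"

definition ext_deriv ::
  "('z::real_normed_vector \<Rightarrow> 'z \<Rightarrow> real) \<Rightarrow> 'z \<Rightarrow> 'z \<Rightarrow> 'z \<Rightarrow> real" where
  "ext_deriv \<alpha> z X Y =
     frechet_derivative (\<lambda>z. \<alpha> z Y) (at z) X - frechet_derivative (\<lambda>z. \<alpha> z X) (at z) Y"

definition Omega :: "'m::real_inner \<times> 'm \<Rightarrow> 'm \<times> 'm \<Rightarrow> 'm \<times> 'm \<Rightarrow> real" where
  "Omega z X Y = - ext_deriv theta z X Y"

definition isotropic ::
  "('b::real_normed_vector, 'm::real_inner \<times> 'm) atlas \<Rightarrow> ('m \<times> 'm) set \<Rightarrow> bool" where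
  "isotropic G \<Gamma> \<longleftrightarrow>
     \<Gamma> \<subseteq> TSphere \<and>
     (\<forall>z\<in>\<Gamma>. \<forall>X\<in>tangent_space G z. \<forall>Y\<in>tangent_space G z. Omega z X Y = 0)"


section \<open>Families of submanifolds with the same oriented lines\<close>

text \<open>\<open>transfer S v i j\<close> is the map from \<open>S i\<close> to \<open>S j\<close> along the common oriented lines.\<close>

definition transfer ::
  "('i \<Rightarrow> 'm::real_inner set) \<Rightarrow> ('i \<Rightarrow> 'm \<Rightarrow> 'm) \<Rightarrow> 'i \<Rightarrow> 'i \<Rightarrow> 'm \<Rightarrow> 'm" where
  "transfer S v i j = inv_into (S j) (Phi (v j)) \<circ> Phi (v i)"

definition signed_dist ::
  "('i \<Rightarrow> 'm::real_inner set) \<Rightarrow> ('i \<Rightarrow> 'm \<Rightarrow> 'm) \<Rightarrow> 'i \<Rightarrow> 'i \<Rightarrow> 'm \<Rightarrow> real" where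
  "signed_dist S v i j q = (q - transfer S v i j q) \<bullet> v i q"

text \<open>The pushforward to \<open>S i\<close> of the vector field \<open>v j\<close> on \<open>S j\<close>.\<close>

definition Vfield ::
  "('i \<Rightarrow> ('b::real_normed_vector, 'm::real_inner) atlas) \<Rightarrow> ('i \<Rightarrow> 'm set) \<Rightarrow> ('i \<Rightarrow> 'm \<Rightarrow> 'm)
    \<Rightarrow> 'i \<Rightarrow> 'i \<Rightarrow> 'm \<Rightarrow> 'm"
where
  "Vfield A S v i j q =
     (let r = transfer S v i j q in mderiv (A j) (transfer S v j i) r (v j r))"

definition Efield ::
  "('i \<Rightarrow> ('b::real_normed_vector, 'm::real_inner) atlas) \<Rightarrow> ('i \<Rightarrow> 'm set) \<Rightarrow> ('i \<Rightarrow> 'm \<Rightarrow> 'm)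
    \<Rightarrow> 'i \<Rightarrow> 'i \<Rightarrow> 'm \<Rightarrow> 'm"
where
  "Efield A S v i j q =
     Vfield A S v i j q - (Vfield A S v i j q \<bullet> v i q) *\<^sub>R v i q"

end

theory Submission
  imports Defs
begin

text \<open>
  Let \<open>\<phi>\<close> be a chart of \<open>S\<^sub>1\<close>, \<open>\<nu> = v\<^sub>1 \<circ> \<phi>\<close>, and \<open>\<phi>\<^sub>j = \<phi> - \<mu>\<^sub>j \<nu>\<close>
  the corresponding chart of \<open>S\<^sub>j\<close>, where \<open>\<mu>\<^sub>j\<close> is the signed distance \<open>\<mu>\<^sub>1\<^sub>j\<close>. Isotropy says
  that the bilinear form \<open>d\<phi>(x) \<bullet> d\<nu>(y)\<close> is symmetric, and then so is \<open>d\<phi>\<^sub>j(x) \<bullet> d\<nu>(y)\<close>. If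
  \<open>d\<phi>\<^sub>j(e\<^sub>j) = \<nu>\<close>, then \<open>d\<phi>\<^sub>j(y) \<bullet> d\<nu>(e\<^sub>j) = \<nu> \<bullet> d\<nu>(y) = 0\<close>, that is
  \<open>d\<phi>(y) \<bullet> d\<nu>(e\<^sub>j) = \<mu>\<^sub>j d\<nu>(y) \<bullet> d\<nu>(e\<^sub>j)\<close>. Since \<open>E\<^sub>1\<^sub>j = \<mu>\<^sub>j d\<nu>(e\<^sub>j)\<close>, this makes \<open>E\<^sub>1\<^sub>j\<close> an
  eigenvector of \<open>X \<mapsto> \<nabla>\<^sub>X v\<^sub>1\<close> with eigenvalue \<open>1/\<mu>\<^sub>j\<close>; comparing two indices gives orthogonality,
  because \<open>\<mu>\<^sub>j \<noteq> \<mu>\<^sub>l\<close>. Moreover \<open>\<nabla>\<^sub>v v = 0\<close> for \<open>v = v\<^sub>1\<close>, so \<open>X \<mapsto> \<nabla>\<^sub>X v\<close>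
  satisfies the Riccati equation along \<open>v\<close>, which yields \<open>K(v, E\<^sub>1\<^sub>j) = -(v \<lambda>\<^sub>j + \<lambda>\<^sub>j\<^sup>2)\<close> for
  \<open>\<lambda>\<^sub>j = 1/\<mu>\<^sub>j\<close>.
\<close>

section \<open>Calculus of C1 and C2 maps\<close>

text \<open>Regularity shapes the proof. Charts and \<open>v 1\<close> are C2, but the fields E_1j
  are only C1: e_j solves a linear system whose coefficients are first derivatives of C2 maps. So
  the field \<open>nabla A X v\<close> is not differentiated through the tangential projection; its
  expansion in the frame needs just one derivative of the frame and of the eigenvalues. A second
  obstacle is that \<open>ricci\<close> sums over an unspecified orthonormal basis extended by
  projection, while the E_1j are not normalized. Hence <R(X,v)v, E_1j> is computed for every
  differentiable tangent field X and seen to depend on the value of X at the point alone; Parseval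
  then replaces the basis by the frame. That E_1j is nonzero rests on the line map being a
  diffeomorphism: a vector killed by d\<nu> and sent by d\<phi> to a multiple of \<nu> is killed by
  the differential of the line map. The \<mu>_j are distinct because equal ones would give S_j and
  S_l a common point on a common line, where their signed distance is zero. A dimension count turns
  the k - 1 orthogonal vectors into a frame.\<close>

lemma frechet_derivative_eqI: "(f has_derivative f') (at x) \<Longrightarrow> frechet_derivative f (at x) = f'"
  by (metis frechet_derivative_at)

lemma linear_eq_sum_Basis:
  fixes f :: "'b::euclidean_space \<Rightarrow> 'c::real_normed_vector"
  assumes "linear f"
  shows "f w = (\<Sum>b\<in>Basis. (w \<bullet> b) *\<^sub>R f b)"
  using linear_sum[OF assms, of "\<lambda>b. (w \<bullet> b) *\<^sub>R b" Basis] linear_scale[OF assms]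
  by (simp add: euclidean_representation)

lemma C1_onI:
  assumes "\<And>x. x \<in> U \<Longrightarrow> (f has_derivative blinfun_apply (f' x)) (at x)" "continuous_on U f'"
  shows "C1_on U f"
  unfolding C1_on_def using assms by (intro exI[of _ f'] conjI ballI)

lemma C2_onI:
  assumes "\<And>x. x \<in> U \<Longrightarrow> (f has_derivative blinfun_apply (f' x)) (at x)" "C1_on U f'"
  shows "C2_on U f"
  unfolding C2_on_def using assms by (intro exI[of _ f'] conjI ballI)

text \<open>In finite dimension, continuity of an operator-valued map can be tested on basis
  vectors. This lets later arguments use \<open>frechet_derivative\<close> in a fixed direction in
  place of a \<open>blinfun\<close> witness.\<close>

lemma C1_on_iff:
  fixes f :: "'b::euclidean_space \<Rightarrow> 'c::real_normed_vector"
  shows "C1_on U f \<longleftrightarrow> (\<forall>x\<in>U. f differentiable (at x)) \<and>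
     (\<forall>w. continuous_on U (\<lambda>x. frechet_derivative f (at x) w))"
proof
  assume "C1_on U f"
  obtain f' where f': "\<And>x. x \<in> U \<Longrightarrow> (f has_derivative blinfun_apply (f' x)) (at x)"
    and c: "continuous_on U f'" using \<open>C1_on U f\<close> unfolding C1_on_def by blast
  have "continuous_on U (\<lambda>x. frechet_derivative f (at x) w)" for w
  proof -
    have "continuous_on U (\<lambda>x. blinfun_apply (f' x) w)"
      by (intro continuous_intros c)
    then show ?thesis
      by (rule continuous_on_eq) (simp add: frechet_derivative_eqI[OF f'])
  qed
  then show "(\<forall>x\<in>U. f differentiable (at x)) \<and>
     (\<forall>w. continuous_on U (\<lambda>x. frechet_derivative f (at x) w))"
    using f' by (auto simp: differentiable_def)
next
  assume A: "(\<forall>x\<in>U. f differentiable (at x)) \<and>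
     (\<forall>w. continuous_on U (\<lambda>x. frechet_derivative f (at x) w))"
  define f' where "f' x = Blinfun (frechet_derivative f (at x))" for x
  have f': "(f has_derivative blinfun_apply (f' x)) (at x)"
    "blinfun_apply (f' x) = frechet_derivative f (at x)" if "x \<in> U" for x
  proof -
    have "(f has_derivative frechet_derivative f (at x)) (at x)"
      using A that frechet_derivative_works by blast
    moreover from this have "blinfun_apply (f' x) = frechet_derivative f (at x)"
      unfolding f'_def by (intro bounded_linear_Blinfun_apply has_derivative_bounded_linear)
    ultimately show "(f has_derivative blinfun_apply (f' x)) (at x)"
      "blinfun_apply (f' x) = frechet_derivative f (at x)" by simp_all
  qed
  have "continuous_on U f'"
  proof (rule continuous_on_blinfun_componentwise)
    fix i :: 'b
    show "continuous_on U (\<lambda>x. blinfun_apply (f' x) i)"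
      by (rule continuous_on_eq[of _ "\<lambda>x. frechet_derivative f (at x) i"]) (use A f'(2) in auto)
  qed
  with f'(1) show "C1_on U f" by (rule C1_onI)
qed

lemma C1_on_differentiable: "C1_on U f \<Longrightarrow> x \<in> U \<Longrightarrow> f differentiable (at x)"
  unfolding C1_on_def differentiable_def by blast

lemma C1_on_cong:
  fixes f :: "'b::euclidean_space \<Rightarrow> 'c::real_normed_vector"
  assumes "open U" "\<And>x. x \<in> U \<Longrightarrow> f x = g x" "C1_on U f"
  shows "C1_on U g"
proof -
  obtain f' where f': "\<And>x. x \<in> U \<Longrightarrow> (f has_derivative blinfun_apply (f' x)) (at x)"
    and c: "continuous_on U f'" using assms(3) unfolding C1_on_def by blast
  have "(g has_derivative blinfun_apply (f' x)) (at x)" if "x \<in> U" for x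
    by (rule has_derivative_transform_within_open[OF f'[OF that] \<open>open U\<close> that]) (simp add: assms)
  then show ?thesis using c by (rule C1_onI)
qed

lemma C1_on_subset: "C1_on U f \<Longrightarrow> V \<subseteq> U \<Longrightarrow> C1_on V f"
  unfolding C1_on_def by (meson continuous_on_subset subsetD)

lemma C1_on_local:
  fixes f :: "'b::euclidean_space \<Rightarrow> 'c::real_normed_vector"
  assumes "\<And>x. x \<in> U \<Longrightarrow> \<exists>V. open V \<and> x \<in> V \<and> C1_on V f"
  shows "C1_on U f"
  unfolding C1_on_iff
proof (intro conjI allI ballI)
  show "f differentiable at x" if "x \<in> U" for x
    using assms[OF that] C1_on_differentiable by blast
  show "continuous_on U (\<lambda>x. frechet_derivative f (at x) w)" for w
    unfolding continuous_on_eq_continuous_within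
  proof
    fix x assume "x \<in> U"
    then obtain V where "open V" "x \<in> V" "C1_on V f" using assms by blast
    then have "isCont (\<lambda>x. frechet_derivative f (at x) w) x"
      using continuous_on_eq_continuous_at unfolding C1_on_iff by blast
    then show "continuous (at x within U) (\<lambda>x. frechet_derivative f (at x) w)"
      using continuous_at_imp_continuous_at_within by blast
  qed
qed

lemma C1_on_continuous: "C1_on U f \<Longrightarrow> continuous_on U f"
  unfolding C1_on_def
  by (meson continuous_at_imp_continuous_on has_derivative_continuous)

lemma C1_on_bilinear:
  fixes f :: "'b::euclidean_space \<Rightarrow> 'c::real_normed_vector"
  assumes "bounded_bilinear pr" "C1_on U f" "C1_on U g"
  shows "C1_on U (\<lambda>x. pr (f x) (g x))"
proof -
  interpret bounded_bilinear pr by fact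
  have d: "((\<lambda>x. pr (f x) (g x)) has_derivative
      (\<lambda>h. pr (f x) (frechet_derivative g (at x) h) + pr (frechet_derivative f (at x) h) (g x))) (at x)"
    if "x \<in> U" for x
    by (intro FDERIV frechet_derivative_works[THEN iffD1] C1_on_differentiable[OF _ that] assms)
  show ?thesis
    unfolding C1_on_iff
  proof (intro conjI allI ballI)
    show "(\<lambda>x. pr (f x) (g x)) differentiable at x" if "x \<in> U" for x
      using d[OF that] differentiable_def by blast
    show "continuous_on U (\<lambda>x. frechet_derivative (\<lambda>x. pr (f x) (g x)) (at x) w)" for w
    proof -
      have "continuous_on U (\<lambda>x. pr (f x) (frechet_derivative g (at x) w) + pr (frechet_derivative f (at x) w) (g x))"
        by (rule continuous_on_add; rule bounded_bilinear.continuous_on[OF assms(1)];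
            rule C1_on_continuous[OF assms(2)] C1_on_continuous[OF assms(3)]
              C1_on_iff[THEN iffD1, OF assms(2), THEN conjunct2, rule_format]
              C1_on_iff[THEN iffD1, OF assms(3), THEN conjunct2, rule_format])
      then show ?thesis
        by (rule continuous_on_eq) (simp add: frechet_derivative_eqI[OF d])
    qed
  qed
qed

lemmas C1_on_scaleR = C1_on_bilinear[OF bounded_bilinear_scaleR]
lemmas C1_on_inner = C1_on_bilinear[OF bounded_bilinear_inner]

lemma C1_on_bounded_linear:
  assumes "bounded_linear T" "C1_on U f"
  shows "C1_on U (\<lambda>x. T (f x))"
proof -
  obtain f' where f': "\<And>x. x \<in> U \<Longrightarrow> (f has_derivative blinfun_apply (f' x)) (at x)"
    and c: "continuous_on U f'" using assms(2) unfolding C1_on_def by blast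
  have "((\<lambda>x. T (f x)) has_derivative blinfun_apply (Blinfun T o\<^sub>L f' x)) (at x)" if "x \<in> U" for x
    unfolding blinfun_compose.rep_eq bounded_linear_Blinfun_apply[OF assms(1)] o_def
    by (rule bounded_linear.has_derivative[OF assms(1) f'[OF that]])
  moreover have "continuous_on U (\<lambda>x. Blinfun T o\<^sub>L f' x)"
    by (rule bounded_bilinear.continuous_on[OF bounded_bilinear_blinfun_compose continuous_on_const c])
  ultimately show ?thesis by (rule C1_onI)
qed

lemma C1_on_const: "C1_on U (\<lambda>x. c)"
proof -
  have "((\<lambda>x. c) has_derivative blinfun_apply 0) (at x)" for x :: 'a
    unfolding zero_blinfun.rep_eq by (rule has_derivative_const)
  then show ?thesis by (rule C1_onI) (rule continuous_on_const)
qed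

lemma C1_on_add:
  assumes "C1_on U f" "C1_on U g"
  shows "C1_on U (\<lambda>x. f x + g x)"
proof -
  obtain f' where f': "\<And>x. x \<in> U \<Longrightarrow> (f has_derivative blinfun_apply (f' x)) (at x)"
    and c: "continuous_on U f'" using assms(1) unfolding C1_on_def by blast
  obtain g' where g': "\<And>x. x \<in> U \<Longrightarrow> (g has_derivative blinfun_apply (g' x)) (at x)"
    and d: "continuous_on U g'" using assms(2) unfolding C1_on_def by blast
  have "((\<lambda>x. f x + g x) has_derivative blinfun_apply (f' x + g' x)) (at x)" if "x \<in> U" for x
    unfolding plus_blinfun.rep_eq by (rule has_derivative_add[OF f'[OF that] g'[OF that]])
  then show ?thesis by (rule C1_onI) (assumption, rule continuous_on_add[OF c d])
qed

lemma C1_on_sum: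
  assumes "\<And>i. i \<in> I \<Longrightarrow> C1_on U (f i)"
  shows "C1_on U (\<lambda>x. \<Sum>i\<in>I. f i x)"
  using assms
proof (induction I rule: infinite_finite_induct)
  case (insert i I)
  have "C1_on U (\<lambda>x. f i x + (\<Sum>i\<in>I. f i x))"
    by (rule C1_on_add) (use insert in blast)+
  then show ?case using insert.hyps by simp
qed (simp_all add: C1_on_const)

lemma C1_on_diff:
  assumes "C1_on U f" "C1_on U g"
  shows "C1_on U (\<lambda>x. f x - g x)"
proof -
  have "C1_on U (\<lambda>x. f x + - g x)"
    by (rule C1_on_add[OF assms(1) C1_on_bounded_linear[OF bounded_linear_minus[OF bounded_linear_ident] assms(2)]])
  then show ?thesis by simp
qed

lemma frechet_derivative_comp:
  assumes "h differentiable (at x)" "g differentiable (at (h x))"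
  shows "(g \<circ> h) differentiable (at x)"
    "frechet_derivative (g \<circ> h) (at x) w = frechet_derivative g (at (h x)) (frechet_derivative h (at x) w)"
  using differentiable_chain_at[OF assms] frechet_derivative_compose[OF assms] by auto

lemma C1_on_compose:
  fixes h :: "'b::euclidean_space \<Rightarrow> 'd::euclidean_space" and g :: "'d \<Rightarrow> 'c::real_normed_vector"
  assumes h: "C1_on U h" and g: "C1_on V g" and im: "h ` U \<subseteq> V"
  shows "C1_on U (g \<circ> h)"
  unfolding C1_on_iff
proof (intro conjI allI ballI)
  note dh = C1_on_differentiable[OF h] and dg = C1_on_differentiable[OF g]
  show "(g \<circ> h) differentiable at x" if "x \<in> U" for x
    using that im by (intro differentiable_chain_at dh dg) auto
  fix w
  \<comment> \<open>The direction in which \<open>g\<close> is differentiated varies with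
    \<open>x\<close> as well. Expanding it over \<open>Basis\<close> leaves fixed directions, in
    which the derivative of \<open>g\<close> is known to be continuous.\<close>
  have eq: "frechet_derivative (g \<circ> h) (at x) w =
      (\<Sum>b\<in>Basis. (frechet_derivative h (at x) w \<bullet> b) *\<^sub>R frechet_derivative g (at (h x)) b)"
    if "x \<in> U" for x
  proof -
    have "h x \<in> V" using that im by blast
    then show ?thesis
      by (simp add: frechet_derivative_comp(2)[OF dh[OF that] dg] linear_eq_sum_Basis[symmetric]
          linear_frechet_derivative dg)
  qed
  have "continuous_on U (\<lambda>x. frechet_derivative g (at (h x)) b)" for b
  proof -
    have "continuous_on V (\<lambda>y. frechet_derivative g (at y) b)" using g unfolding C1_on_iff by blast
    then show ?thesis using continuous_on_compose2[OF _ C1_on_continuous[OF h] im] by blast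
  qed
  then have "continuous_on U (\<lambda>x. \<Sum>b\<in>Basis. (frechet_derivative h (at x) w \<bullet> b) *\<^sub>R frechet_derivative g (at (h x)) b)"
    using h unfolding C1_on_iff by (intro continuous_intros) auto
  then show "continuous_on U (\<lambda>x. frechet_derivative (g \<circ> h) (at x) w)"
    by (rule continuous_on_eq) (simp add: eq)
qed

section \<open>Maps of class C2\<close>

lemma C2_on_iff:
  fixes f :: "'b::euclidean_space \<Rightarrow> 'c::real_normed_vector"
  assumes "open U"
  shows "C2_on U f \<longleftrightarrow> (\<forall>x\<in>U. f differentiable (at x)) \<and>
     (\<forall>w. C1_on U (\<lambda>x. frechet_derivative f (at x) w))"
proof
  assume "C2_on U f"
  obtain f' where f': "\<And>x. x \<in> U \<Longrightarrow> (f has_derivative blinfun_apply (f' x)) (at x)"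
    and c: "C1_on U f'" using \<open>C2_on U f\<close> unfolding C2_on_def by blast
  have "C1_on U (\<lambda>x. blinfun_apply (f' x) w)" for w
    by (rule C1_on_bounded_linear[OF blinfun.bounded_linear_left c])
  then have "C1_on U (\<lambda>x. frechet_derivative f (at x) w)" for w
    by (rule C1_on_cong[OF assms, rotated]) (simp add: frechet_derivative_eqI[OF f'])
  moreover have "f differentiable (at x)" if "x \<in> U" for x
    by (rule differentiableI[OF f'[OF that]])
  ultimately show "(\<forall>x\<in>U. f differentiable (at x)) \<and> (\<forall>w. C1_on U (\<lambda>x. frechet_derivative f (at x) w))"
    by simp
next
  assume A: "(\<forall>x\<in>U. f differentiable (at x)) \<and> (\<forall>w. C1_on U (\<lambda>x. frechet_derivative f (at x) w))"
  \<comment> \<open>A sum of rank-one operators: \<open>f'\<close> depends on the directional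
    derivatives through fixed bounded linear maps and so inherits C1 from them.\<close>
  define f' where "f' x = (\<Sum>b\<in>Basis. blinfun_scaleR_left (frechet_derivative f (at x) b) o\<^sub>L blinfun_inner_left b)" for x
  have "(f has_derivative blinfun_apply (f' x)) (at x)" if "x \<in> U" for x
  proof -
    have d: "f differentiable (at x)" using A that by blast
    have "blinfun_apply (f' x) w = frechet_derivative f (at x) w" for w
      unfolding f'_def blinfun.sum_left
      by (simp add: linear_eq_sum_Basis[OF linear_frechet_derivative[OF d], of w, symmetric])
    then have "blinfun_apply (f' x) = frechet_derivative f (at x)" by (rule ext)
    with d show ?thesis unfolding frechet_derivative_works by simp
  qed
  moreover have "C1_on U f'"
  proof -
    have "bounded_linear (\<lambda>y :: 'c. blinfun_scaleR_left y o\<^sub>L blinfun_inner_left b)" for b :: 'b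
      by (rule bounded_linear_compose[OF bounded_bilinear.bounded_linear_left[OF bounded_bilinear_blinfun_compose]
            bounded_linear_blinfun_scaleR_left])
    from C1_on_bounded_linear[OF this A[THEN conjunct2, rule_format]]
    show ?thesis unfolding f'_def by (rule C1_on_sum)
  qed
  ultimately show "C2_on U f" by (rule C2_onI)
qed

lemma C2_on_differentiable: "C2_on U f \<Longrightarrow> x \<in> U \<Longrightarrow> f differentiable (at x)"
  unfolding C2_on_def differentiable_def by blast

lemma C2_on_subset:
  assumes "C2_on U f" "V \<subseteq> U"
  shows "C2_on V f"
proof -
  obtain f' where f': "\<And>x. x \<in> U \<Longrightarrow> (f has_derivative blinfun_apply (f' x)) (at x)"
    and c: "C1_on U f'" using assms(1) unfolding C2_on_def by blast
  show ?thesis by (rule C2_onI[OF f' C1_on_subset[OF c assms(2)]]) (use assms(2) in blast)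
qed

lemma C2_on_imp_C1_on:
  fixes f :: "'b::euclidean_space \<Rightarrow> 'c::real_normed_vector"
  assumes "C2_on U f"
  shows "C1_on U f"
proof -
  obtain f' where f': "\<And>x. x \<in> U \<Longrightarrow> (f has_derivative blinfun_apply (f' x)) (at x)"
    and c: "C1_on U f'" using assms unfolding C2_on_def by blast
  show ?thesis by (rule C1_onI[OF f' C1_on_continuous[OF c]])
qed

lemma C2_on_cong:
  fixes f :: "'b::euclidean_space \<Rightarrow> 'c::real_normed_vector"
  assumes "open U" "\<And>x. x \<in> U \<Longrightarrow> f x = g x" "C2_on U f"
  shows "C2_on U g"
proof -
  obtain f' where f': "\<And>x. x \<in> U \<Longrightarrow> (f has_derivative blinfun_apply (f' x)) (at x)"
    and c: "C1_on U f'" using assms(3) unfolding C2_on_def by blast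
  have "(g has_derivative blinfun_apply (f' x)) (at x)" if "x \<in> U" for x
    by (rule has_derivative_transform_within_open[OF f'[OF that] \<open>open U\<close> that]) (simp add: assms)
  then show ?thesis using c by (rule C2_onI)
qed

lemma C2_on_local:
  fixes f :: "'b::euclidean_space \<Rightarrow> 'c::real_normed_vector"
  assumes "open U" "\<And>x. x \<in> U \<Longrightarrow> \<exists>V. open V \<and> x \<in> V \<and> C2_on V f"
  shows "C2_on U f"
  unfolding C2_on_iff[OF \<open>open U\<close>]
proof (intro conjI allI ballI)
  show "f differentiable at x" if "x \<in> U" for x
    using assms(2)[OF that] C2_on_differentiable by blast
  show "C1_on U (\<lambda>x. frechet_derivative f (at x) w)" for w
  proof (rule C1_on_local)
    fix x assume "x \<in> U"
    then obtain V where "open V" "x \<in> V" "C2_on V f" using assms(2) by blast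
    then show "\<exists>V. open V \<and> x \<in> V \<and> C1_on V (\<lambda>x. frechet_derivative f (at x) w)"
      using C2_on_iff[OF \<open>open V\<close>, THEN iffD1] by auto
  qed
qed

lemma C2_on_compose:
  fixes h :: "'b::euclidean_space \<Rightarrow> 'd::euclidean_space" and g :: "'d \<Rightarrow> 'c::real_normed_vector"
  assumes h: "C2_on U h" and g: "C2_on V g" and im: "h ` U \<subseteq> V" and o: "open U" "open V"
  shows "C2_on U (g \<circ> h)"
  unfolding C2_on_iff[OF \<open>open U\<close>]
proof (intro conjI allI ballI)
  note dh = C2_on_differentiable[OF h] and dg = C2_on_differentiable[OF g]
  show "(g \<circ> h) differentiable at x" if "x \<in> U" for x
    using that im by (intro differentiable_chain_at dh dg) auto
  fix w
  have eq: "frechet_derivative (g \<circ> h) (at x) w =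
      (\<Sum>b\<in>Basis. (frechet_derivative h (at x) w \<bullet> b) *\<^sub>R ((\<lambda>y. frechet_derivative g (at y) b) \<circ> h) x)"
    if "x \<in> U" for x
  proof -
    have "h x \<in> V" using that im by blast
    then show ?thesis
      by (simp add: frechet_derivative_comp(2)[OF dh[OF that] dg] linear_eq_sum_Basis[symmetric]
          linear_frechet_derivative dg)
  qed
  have "C1_on U (\<lambda>x. \<Sum>b\<in>Basis. (frechet_derivative h (at x) w \<bullet> b) *\<^sub>R ((\<lambda>y. frechet_derivative g (at y) b) \<circ> h) x)"
    by (intro C1_on_sum C1_on_scaleR C1_on_inner C1_on_const
        C1_on_compose[OF C2_on_imp_C1_on[OF h] _ im]
        C2_on_iff[OF o(1), THEN iffD1, OF h, THEN conjunct2, rule_format]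
        C2_on_iff[OF o(2), THEN iffD1, OF g, THEN conjunct2, rule_format])
  then show "C1_on U (\<lambda>x. frechet_derivative (g \<circ> h) (at x) w)"
    by (rule C1_on_cong[OF o(1), rotated]) (simp add: eq)
qed

section \<open>Linear systems with C1 coefficients\<close>

lemmas has_derivative_frechet_derivative = frechet_derivative_works[THEN iffD1]

text \<open>Where \<open>g\<close> vanishes, the product rule has no term with a derivative of
  \<open>q\<close>, so continuity of \<open>q\<close> suffices. In
  \<open>differentiable_solution\<close> the factor \<open>q\<close> is a coordinate of the very map
  whose differentiability is being proved.\<close>

lemma has_derivative_scaleR_vanishing:
  fixes g :: "'b::real_normed_vector \<Rightarrow> 'c::real_normed_vector"
  assumes q: "isCont q u" and g: "(g has_derivative g') (at u)" and "g u = 0"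
  shows "((\<lambda>x. q x *\<^sub>R g x) has_derivative (\<lambda>h. q u *\<^sub>R g' h)) (at u)"
proof -
  have bl: "bounded_linear g'" using g by (rule has_derivative_bounded_linear)
  obtain K where K: "\<And>h. norm (g' h) \<le> norm h * K" using bounded_linear.bounded[OF bl] by blast
  define e where "e y = (g y - g u - g' (y - u)) /\<^sub>R norm (y - u)" for y
  have e: "(e \<longlongrightarrow> 0) (at u)" using g unfolding e_def has_derivative_at_within by simp
  have "((\<lambda>y. (q y *\<^sub>R g y - q u *\<^sub>R g u - q u *\<^sub>R g' (y - u)) /\<^sub>R norm (y - u)) \<longlongrightarrow> 0) (at u)"
  proof (rule Lim_null_comparison)
    show "\<forall>\<^sub>F y in at u. norm ((q y *\<^sub>R g y - q u *\<^sub>R g u - q u *\<^sub>R g' (y - u)) /\<^sub>R norm (y - u))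
        \<le> \<bar>q y\<bar> * norm (e y) + \<bar>q y - q u\<bar> * \<bar>K\<bar>"
      unfolding eventually_at_filter
    proof (rule always_eventually, intro allI impI)
      fix y assume "y \<noteq> u"
      then have n: "norm (y - u) > 0" by simp
      have "norm (g' (y - u)) \<le> norm (y - u) * \<bar>K\<bar>"
        using K[of "y - u"] abs_ge_self[of K] by (meson mult_left_mono norm_ge_zero order_trans)
      then have k: "norm (g' (y - u) /\<^sub>R norm (y - u)) \<le> \<bar>K\<bar>"
        using n by (simp add: field_simps)
      have "(q y *\<^sub>R g y - q u *\<^sub>R g u - q u *\<^sub>R g' (y - u)) /\<^sub>R norm (y - u)
          = q y *\<^sub>R e y + (q y - q u) *\<^sub>R (g' (y - u) /\<^sub>R norm (y - u))"
        using \<open>g u = 0\<close> by (simp add: e_def algebra_simps)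
      also have "norm \<dots> \<le> \<bar>q y\<bar> * norm (e y) + \<bar>q y - q u\<bar> * norm (g' (y - u) /\<^sub>R norm (y - u))"
        by (rule norm_triangle_le) (simp only: norm_scaleR order_refl)
      also have "\<dots> \<le> \<bar>q y\<bar> * norm (e y) + \<bar>q y - q u\<bar> * \<bar>K\<bar>"
        using k by (intro add_left_mono mult_left_mono) auto
      finally show "norm ((q y *\<^sub>R g y - q u *\<^sub>R g u - q u *\<^sub>R g' (y - u)) /\<^sub>R norm (y - u))
        \<le> \<bar>q y\<bar> * norm (e y) + \<bar>q y - q u\<bar> * \<bar>K\<bar>" .
    qed
    have "((\<lambda>y. \<bar>q y\<bar> * norm (e y) + \<bar>q y - q u\<bar> * \<bar>K\<bar>) \<longlongrightarrow> \<bar>q u\<bar> * norm (0::'c) + \<bar>q u - q u\<bar> * \<bar>K\<bar>) (at u)"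
      by (intro tendsto_intros e q[unfolded isCont_def])
    then show "((\<lambda>y. \<bar>q y\<bar> * norm (e y) + \<bar>q y - q u\<bar> * \<bar>K\<bar>) \<longlongrightarrow> 0) (at u)" by simp
  qed
  moreover have "bounded_linear (\<lambda>h. q u *\<^sub>R g' h)"
    using bl by (rule bounded_linear_const_scaleR)
  ultimately show ?thesis unfolding has_derivative_at_within by simp
qed

lemma linear_diff_expand:
  fixes f g :: "'b::euclidean_space \<Rightarrow> 'c::real_normed_vector"
  assumes "linear f" "linear g"
  shows "f w - g w = (\<Sum>b\<in>Basis. (w \<bullet> b) *\<^sub>R (f b - g b))"
proof -
  have "f w - g w = (\<Sum>b\<in>Basis. (w \<bullet> b) *\<^sub>R f b) - (\<Sum>b\<in>Basis. (w \<bullet> b) *\<^sub>R g b)"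
    using linear_eq_sum_Basis[OF assms(1), of w] linear_eq_sum_Basis[OF assms(2), of w] by (rule arg_cong2)
  then show ?thesis by (simp only: sum_subtractf scaleR_diff_right)
qed

text \<open>Injectivity at the single point \<open>u\<close> bounds \<open>norm (L u w)\<close>
  below by \<open>m * norm w\<close>. Near \<open>u\<close>, passing from \<open>L u\<close> to
  \<open>L x\<close> costs at most half of \<open>m\<close>, so \<open>y x - y u\<close> is
  controlled by \<open>c x - L x (y u)\<close>, which tends to zero. \<open>L x\<close> may have a
  target of larger dimension, as derivatives of charts do.\<close>

lemma isCont_solution:
  fixes L :: "'d::euclidean_space \<Rightarrow> 'b::euclidean_space \<Rightarrow> 'a::euclidean_space"
  assumes U: "open U" "u \<in> U"
    and lin: "\<And>x. x \<in> U \<Longrightarrow> linear (L x)" and inj: "inj (L u)"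
    and cL: "\<And>b. isCont (\<lambda>x. L x b) u" and cc: "isCont c u"
    and eq: "\<And>x. x \<in> U \<Longrightarrow> L x (y x) = c x"
  shows "isCont y u"
proof -
  obtain m where m: "m > 0" "\<And>w. m * norm w \<le> norm (L u w)"
    using linear_inj_bounded_below_pos[OF lin[OF U(2)] inj] by blast
  define \<delta> where "\<delta> x = (\<Sum>b\<in>Basis. norm (L x b - L u b))" for x
  have \<delta>: "norm (L x w - L u w) \<le> \<delta> x * norm w" if "x \<in> U" for x w
  proof -
    have "norm (L x w - L u w) \<le> (\<Sum>b\<in>Basis. norm ((w \<bullet> b) *\<^sub>R (L x b - L u b)))"
      by (subst linear_diff_expand[OF lin[OF that] lin[OF U(2)]]) (rule norm_sum)
    also have "\<dots> \<le> (\<Sum>b\<in>Basis. norm w * norm (L x b - L u b))"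
      by (intro sum_mono) (simp add: Basis_le_norm mult_right_mono)
    finally show ?thesis unfolding \<delta>_def by (simp add: sum_distrib_left mult.commute)
  qed
  have "(\<delta> \<longlongrightarrow> (\<Sum>b\<in>Basis. norm (L u b - L u b))) (at u)"
    unfolding \<delta>_def by (intro tendsto_intros cL[unfolded isCont_def])
  then have "(\<delta> \<longlongrightarrow> 0) (at u)" by simp
  then have ev1: "\<forall>\<^sub>F x in at u. \<delta> x < m / 2"
    using m(1) by (intro order_tendstoD(2)) auto
  have ev2: "\<forall>\<^sub>F x in at u. x \<in> U"
    using U eventually_at_topological by blast
  have "((\<lambda>x. (2 / m) * norm (c x - L x (y u))) \<longlongrightarrow> (2 / m) * norm (c u - L u (y u))) (at u)"
    by (intro tendsto_intros cL[unfolded isCont_def] cc[unfolded isCont_def])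
  then have lim: "((\<lambda>x. (2 / m) * norm (c x - L x (y u))) \<longlongrightarrow> 0) (at u)"
    using eq[OF U(2)] by simp
  have "((\<lambda>x. y x - y u) \<longlongrightarrow> 0) (at u)"
  proof (rule Lim_null_comparison[OF _ lim])
    show "\<forall>\<^sub>F x in at u. norm (y x - y u) \<le> (2 / m) * norm (c x - L x (y u))"
      using ev1 ev2
    proof eventually_elim
      case (elim x)
      let ?d = "y x - y u"
      have "L x ?d = c x - L x (y u)" using linear_diff[OF lin[OF elim(2)]] eq[OF elim(2)] by simp
      then have "L u ?d = (c x - L x (y u)) - (L x ?d - L u ?d)" by simp
      then have "norm (L u ?d) \<le> norm (c x - L x (y u)) + norm (L x ?d - L u ?d)"
        by (metis norm_triangle_ineq4)
      moreover have "norm (L x ?d - L u ?d) \<le> m / 2 * norm ?d"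
        using \<delta>[OF elim(2), of ?d] elim(1) mult_right_mono[of "\<delta> x" "m/2" "norm ?d"] by simp
      ultimately have "m / 2 * norm ?d \<le> norm (c x - L x (y u))" using m(2)[of ?d] by simp
      then show ?case using m(1) by (simp add: field_simps)
    qed
  qed
  then show ?thesis unfolding isCont_def by (simp add: LIM_zero_iff)
qed

text \<open>With a left inverse \<open>P\<close> of \<open>L u\<close>, the system reads
  \<open>y x = P (c x) + P (L u (y x) - L x (y x))\<close>. Over \<open>Basis\<close>, each
  \<open>L u b - L x b\<close> vanishes at \<open>u\<close>, so continuity of \<open>y\<close> is
  enough to differentiate the right-hand side.\<close>

lemma differentiable_solution:
  fixes L :: "'d::euclidean_space \<Rightarrow> 'b::euclidean_space \<Rightarrow> 'a::euclidean_space"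
  assumes U: "open U" "u \<in> U"
    and lin: "\<And>x. x \<in> U \<Longrightarrow> linear (L x)" and inj: "inj (L u)"
    and dL: "\<And>b. (\<lambda>x. L x b) differentiable (at u)" and dc: "c differentiable (at u)"
    and eq: "\<And>x. x \<in> U \<Longrightarrow> L x (y x) = c x"
  shows "y differentiable (at u)"
proof -
  have y: "isCont y u"
    by (rule isCont_solution[OF U lin inj differentiable_imp_continuous_within[OF dL]
          differentiable_imp_continuous_within[OF dc] eq])
  obtain P where P: "linear P" "P \<circ> L u = id"
    using linear_injective_left_inverse[OF lin[OF U(2)] inj] by blast
  have bP: "bounded_linear P" using P(1) linear_conv_bounded_linear by blast
  have d: "((\<lambda>x. (y x \<bullet> b) *\<^sub>R (L u b - L x b)) has_derivative
      (\<lambda>h. (y u \<bullet> b) *\<^sub>R - frechet_derivative (\<lambda>x. L x b) (at u) h)) (at u)" for b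
  proof (rule has_derivative_scaleR_vanishing)
    show "isCont (\<lambda>x. y x \<bullet> b) u" using y by (intro continuous_intros)
    show "((\<lambda>x. L u b - L x b) has_derivative (\<lambda>h. - frechet_derivative (\<lambda>x. L x b) (at u) h)) (at u)"
      using has_derivative_diff[OF has_derivative_const has_derivative_frechet_derivative[OF dL]] by simp
  qed simp
  have "(\<lambda>x. P (c x) + P (\<Sum>b\<in>Basis. (y x \<bullet> b) *\<^sub>R (L u b - L x b))) differentiable (at u)"
    by (rule differentiableI[OF has_derivative_add[OF bounded_linear.has_derivative[OF bP has_derivative_frechet_derivative[OF dc]]
         bounded_linear.has_derivative[OF bP has_derivative_sum[OF d]]]])
  then obtain D where "((\<lambda>x. P (c x) + P (\<Sum>b\<in>Basis. (y x \<bullet> b) *\<^sub>R (L u b - L x b))) has_derivative D) (at u)"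
    unfolding differentiable_def by blast
  then have "(y has_derivative D) (at u)"
  proof (rule has_derivative_transform_within_open[OF _ U])
    fix x assume x: "x \<in> U"
    have "P (c x) + P (\<Sum>b\<in>Basis. (y x \<bullet> b) *\<^sub>R (L u b - L x b)) = P (L x (y x)) + P (L u (y x) - L x (y x))"
      unfolding linear_diff_expand[OF lin[OF U(2)] lin[OF x], of "y x", symmetric] eq[OF x] ..
    also have "\<dots> = P (L u (y x))" using linear_diff[OF P(1)] by simp
    also have "\<dots> = y x" using P(2) by (metis comp_apply id_apply)
    finally show "P (c x) + P (\<Sum>b\<in>Basis. (y x \<bullet> b) *\<^sub>R (L u b - L x b)) = y x" .
  qed
  then show ?thesis by (rule differentiableI)
qed

text \<open>The product rule for a matrix acting on a vector, expanded over \<open>Basis\<close>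
  because differentiability of \<open>L\<close> is assumed column by column.\<close>

lemma has_derivative_linear_application:
  fixes L :: "'d::euclidean_space \<Rightarrow> 'b::euclidean_space \<Rightarrow> 'a::euclidean_space"
  assumes U: "open U" "u \<in> U"
    and lin: "\<And>x. x \<in> U \<Longrightarrow> linear (L x)"
    and dL: "\<And>b. (\<lambda>x. L x b) differentiable (at u)" and dy: "y differentiable (at u)"
    and eq: "\<And>x. x \<in> U \<Longrightarrow> L x (y x) = c x"
  shows "frechet_derivative c (at u) h = L u (frechet_derivative y (at u) h) +
    (\<Sum>b\<in>Basis. (y u \<bullet> b) *\<^sub>R frechet_derivative (\<lambda>x. L x b) (at u) h)"
proof -
  have "((\<lambda>x. \<Sum>b\<in>Basis. (y x \<bullet> b) *\<^sub>R L x b) has_derivative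
    (\<lambda>h. \<Sum>b\<in>Basis. (y u \<bullet> b) *\<^sub>R frechet_derivative (\<lambda>x. L x b) (at u) h +
      (frechet_derivative y (at u) h \<bullet> b) *\<^sub>R L u b)) (at u)"
    by (intro has_derivative_sum has_derivative_scaleR has_derivative_inner_left
        has_derivative_frechet_derivative dL dy)
  then have "(c has_derivative
    (\<lambda>h. \<Sum>b\<in>Basis. (y u \<bullet> b) *\<^sub>R frechet_derivative (\<lambda>x. L x b) (at u) h +
      (frechet_derivative y (at u) h \<bullet> b) *\<^sub>R L u b)) (at u)"
  proof (rule has_derivative_transform_within_open[OF _ U])
    fix x assume "x \<in> U"
    then show "(\<Sum>b\<in>Basis. (y x \<bullet> b) *\<^sub>R L x b) = c x"
      using linear_eq_sum_Basis[OF lin, of x "y x"] eq by simp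
  qed
  then show ?thesis
    unfolding linear_eq_sum_Basis[OF lin[OF U(2)], of "frechet_derivative y (at u) h"]
    by (subst frechet_derivative_eqI, assumption) (simp only: sum.distrib add.commute)
qed

text \<open>Differentiating \<open>L x (y x) = c x\<close> shows that the directional derivatives of
  \<open>y\<close> solve a system with the same \<open>L\<close> and a continuous right-hand side,
  so \<open>isCont_solution\<close> applies a second time.\<close>

lemma C1_on_solution:
  fixes L :: "'d::euclidean_space \<Rightarrow> 'b::euclidean_space \<Rightarrow> 'a::euclidean_space"
  assumes U: "open U"
    and lin: "\<And>x. x \<in> U \<Longrightarrow> linear (L x)" and inj: "\<And>x. x \<in> U \<Longrightarrow> inj (L x)"
    and L: "\<And>b. C1_on U (\<lambda>x. L x b)" and c: "C1_on U c"
    and eq: "\<And>x. x \<in> U \<Longrightarrow> L x (y x) = c x"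
  shows "C1_on U y"
proof -
  note dL = C1_on_differentiable[OF L] and dc = C1_on_differentiable[OF c]
  have isC: "isCont f x" if "C1_on U f" "x \<in> U" for f :: "'d \<Rightarrow> 'a" and x
    using differentiable_imp_continuous_within[OF C1_on_differentiable[OF that]] by simp
  have isD: "isCont (\<lambda>x. frechet_derivative f (at x) w) x" if "C1_on U f" "x \<in> U" for f :: "'d \<Rightarrow> 'a" and w x
    using that U C1_on_iff continuous_on_eq_continuous_at by metis
  have dy: "y differentiable (at x)" if "x \<in> U" for x
    by (rule differentiable_solution[OF U that lin inj[OF that] dL[OF that] dc[OF that] eq])
  have Dy: "L x (frechet_derivative y (at x) h) = frechet_derivative c (at x) h -
      (\<Sum>b\<in>Basis. (y x \<bullet> b) *\<^sub>R frechet_derivative (\<lambda>x. L x b) (at x) h)" if "x \<in> U" for x h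
    using has_derivative_linear_application[OF U that lin dL[OF that] dy[OF that] eq, of h] by simp
  have "isCont (\<lambda>x. frechet_derivative y (at x) h) x" if "x \<in> U" for x h
  proof (rule isCont_solution[OF U that lin inj[OF that] isC[OF L that] _ Dy])
    show "isCont (\<lambda>x. frechet_derivative c (at x) h -
      (\<Sum>b\<in>Basis. (y x \<bullet> b) *\<^sub>R frechet_derivative (\<lambda>x. L x b) (at x) h)) x"
      using differentiable_imp_continuous_within[OF dy[OF that]]
      by (intro continuous_diff isD[OF c that] continuous_sum continuous_scaleR isD[OF L that] continuous_inner continuous_const)
  qed
  then show ?thesis
    unfolding C1_on_iff by (intro conjI ballI allI dy continuous_at_imp_continuous_on) auto
qed

section \<open>Symmetry of second derivatives\<close>

text \<open>The mean value theorem, once along \<open>x\<close> and once along \<open>y\<close>. It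
  concerns real functions, hence the inner product with a fixed \<open>a\<close>; the intermediate
  point may depend on \<open>a\<close>.\<close>

lemma mixed_difference:
  fixes f :: "'b::euclidean_space \<Rightarrow> 'a::euclidean_space"
  assumes U: "open U" and f: "C2_on U f" and h: "h > 0"
    and inU: "\<And>s t. 0 \<le> s \<Longrightarrow> s \<le> h \<Longrightarrow> 0 \<le> t \<Longrightarrow> t \<le> h \<Longrightarrow> u + s *\<^sub>R x + t *\<^sub>R y \<in> U"
  shows "\<exists>s t. 0 \<le> s \<and> s \<le> h \<and> 0 \<le> t \<and> t \<le> h \<and>
    (f (u + h *\<^sub>R x + h *\<^sub>R y) - f (u + h *\<^sub>R x) - f (u + h *\<^sub>R y) + f u) \<bullet> a =
    h * h * (frechet_derivative (\<lambda>z. frechet_derivative f (at z) x) (at (u + s *\<^sub>R x + t *\<^sub>R y)) y \<bullet> a)"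
proof -
  have df: "(f has_derivative frechet_derivative f (at z)) (at z)" if "z \<in> U" for z
    by (rule has_derivative_frechet_derivative[OF C2_on_differentiable[OF f that]])
  have C: "C1_on U (\<lambda>z. frechet_derivative f (at z) x)"
    using f unfolding C2_on_iff[OF U] by blast
  have dG: "((\<lambda>z. frechet_derivative f (at z) x) has_derivative frechet_derivative (\<lambda>z. frechet_derivative f (at z) x) (at z)) (at z)" if "z \<in> U" for z
    by (rule has_derivative_frechet_derivative[OF C1_on_differentiable[OF C that]])
  have line: "((\<lambda>r. g (p + r *\<^sub>R w) \<bullet> a) has_real_derivative (g' w \<bullet> a)) (at r)"
    if g: "(g has_derivative g') (at (p + r *\<^sub>R w))" for g :: "'b \<Rightarrow> 'a" and g' p w r
  proof -
    have "((\<lambda>r. p + r *\<^sub>R w) has_derivative (\<lambda>r. r *\<^sub>R w)) (at r)"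
      by (auto intro!: derivative_eq_intros)
    from has_derivative_inner_left[OF has_derivative_compose[OF this g], of a]
    have "((\<lambda>r. g (p + r *\<^sub>R w) \<bullet> a) has_derivative (\<lambda>r. g' (r *\<^sub>R w) \<bullet> a)) (at r)" .
    then show ?thesis
      using linear_scale[OF has_derivative_linear[OF g]]
      by (simp add: has_field_derivative_def mult_commute_abs)
  qed
  have e1: "\<exists>s>0. s < h \<and> (\<lambda>s. f (u + h *\<^sub>R y + s *\<^sub>R x) \<bullet> a - f (u + s *\<^sub>R x) \<bullet> a) h - (\<lambda>s. f (u + h *\<^sub>R y + s *\<^sub>R x) \<bullet> a - f (u + s *\<^sub>R x) \<bullet> a) 0 =
     (h - 0) * (frechet_derivative f (at (u + h *\<^sub>R y + s *\<^sub>R x)) x \<bullet> a - frechet_derivative f (at (u + s *\<^sub>R x)) x \<bullet> a)"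
  proof (rule MVT2[OF h])
    fix s assume s: "0 \<le> s" "s \<le> h"
    have z: "u + h *\<^sub>R y + s *\<^sub>R x \<in> U" "u + s *\<^sub>R x \<in> U"
      using inU[OF s, of h] inU[OF s, of 0] h by (simp_all add: add.assoc add.commute add.left_commute)
    show "((\<lambda>s. f (u + h *\<^sub>R y + s *\<^sub>R x) \<bullet> a - f (u + s *\<^sub>R x) \<bullet> a) has_real_derivative
      (frechet_derivative f (at (u + h *\<^sub>R y + s *\<^sub>R x)) x \<bullet> a - frechet_derivative f (at (u + s *\<^sub>R x)) x \<bullet> a)) (at s)"
      by (intro DERIV_diff line df z)
  qed
  then obtain s where s: "0 < s" "s < h" and s_eq:
    "(f (u + h *\<^sub>R x + h *\<^sub>R y) - f (u + h *\<^sub>R x) - f (u + h *\<^sub>R y) + f u) \<bullet> a =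
     h * (frechet_derivative f (at (u + s *\<^sub>R x + h *\<^sub>R y)) x \<bullet> a - frechet_derivative f (at (u + s *\<^sub>R x)) x \<bullet> a)"
    by (auto simp: algebra_simps inner_diff_left inner_add_left)
  have e2: "\<exists>t>0. t < h \<and> (\<lambda>t. frechet_derivative f (at (u + s *\<^sub>R x + t *\<^sub>R y)) x \<bullet> a) h - (\<lambda>t. frechet_derivative f (at (u + s *\<^sub>R x + t *\<^sub>R y)) x \<bullet> a) 0 =
     (h - 0) * (frechet_derivative (\<lambda>z. frechet_derivative f (at z) x) (at (u + s *\<^sub>R x + t *\<^sub>R y)) y \<bullet> a)"
  proof (rule MVT2[OF h])
    fix t assume "0 \<le> t" "t \<le> h"
    then show "((\<lambda>t. frechet_derivative f (at (u + s *\<^sub>R x + t *\<^sub>R y)) x \<bullet> a) has_real_derivative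
      frechet_derivative (\<lambda>z. frechet_derivative f (at z) x) (at (u + s *\<^sub>R x + t *\<^sub>R y)) y \<bullet> a) (at t)"
      using s by (intro line[where g = "\<lambda>z. frechet_derivative f (at z) x"] dG inU) auto
  qed
  then obtain t where "0 < t" "t < h" "frechet_derivative f (at (u + s *\<^sub>R x + h *\<^sub>R y)) x \<bullet> a - frechet_derivative f (at (u + s *\<^sub>R x)) x \<bullet> a =
     h * (frechet_derivative (\<lambda>z. frechet_derivative f (at z) x) (at (u + s *\<^sub>R x + t *\<^sub>R y)) y \<bullet> a)"
    by auto
  then show ?thesis
    using s unfolding s_eq by (intro exI[of _ s] exI[of _ t]) (simp add: mult.assoc)
qed

text \<open>The second difference of \<open>f\<close> over a parallelogram is symmetric in
  \<open>x\<close> and \<open>y\<close>. Divided by \<open>h * h\<close> it is a value of either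
  mixed derivative at some nearby point, so continuity of both at \<open>u\<close> leaves no gap
  between them.\<close>

lemma second_derivative_symmetric:
  fixes f :: "'b::euclidean_space \<Rightarrow> 'a::euclidean_space"
  assumes U: "open U" "u \<in> U" and f: "C2_on U f"
  shows "frechet_derivative (\<lambda>z. frechet_derivative f (at z) x) (at u) y =
    frechet_derivative (\<lambda>z. frechet_derivative f (at z) y) (at u) x"
proof -
  define Q where "Q x y z = frechet_derivative (\<lambda>z. frechet_derivative f (at z) x) (at z) y" for x y z
  have Qc: "isCont (\<lambda>z. Q x y z \<bullet> a) u" for x y a
  proof -
    have C: "C1_on U (\<lambda>z. frechet_derivative f (at z) x)"
      using f unfolding C2_on_iff[OF U(1)] by blast
    have "continuous_on U (Q x y)"
      unfolding Q_def by (rule C1_on_iff[THEN iffD1, OF C, THEN conjunct2, rule_format])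
    then have "isCont (Q x y) u" using U continuous_on_eq_continuous_at by blast
    then show ?thesis by (intro continuous_intros)
  qed
  have "Q x y u \<bullet> a = Q y x u \<bullet> a" for a
  proof (rule ccontr)
    assume ne: "Q x y u \<bullet> a \<noteq> Q y x u \<bullet> a"
    define e where "e = \<bar>Q x y u \<bullet> a - Q y x u \<bullet> a\<bar> / 2"
    have e: "e > 0" using ne by (simp add: e_def)
    obtain d0 where d0: "d0 > 0" "ball u d0 \<subseteq> U" using U open_contains_ball by blast
    obtain d1 where d1: "d1 > 0" "\<And>z. dist z u < d1 \<Longrightarrow> dist (Q x y z \<bullet> a) (Q x y u \<bullet> a) < e"
      using Qc[of x y a, unfolded continuous_at_eps_delta] e by blast
    obtain d2 where d2: "d2 > 0" "\<And>z. dist z u < d2 \<Longrightarrow> dist (Q y x z \<bullet> a) (Q y x u \<bullet> a) < e"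
      using Qc[of y x a, unfolded continuous_at_eps_delta] e by blast
    define d where "d = min d0 (min d1 d2)"
    have d: "d > 0" using d0 d1 d2 by (simp add: d_def)
    \<comment> \<open>This step size keeps the parallelogram spanned at \<open>u\<close> by the
      multiples of \<open>x\<close> and \<open>y\<close> within distance \<open>d\<close> of
      \<open>u\<close>; the summand 1 covers the case that both vectors vanish.\<close>
    define h where "h = d / (norm x + norm y + 1)"
    have np: "norm x + norm y + 1 > 0" by (smt (verit) norm_ge_zero)
    have h: "h > 0" using d np by (simp add: h_def)
    have near: "dist (u + s *\<^sub>R x + t *\<^sub>R y) u < d" if "0 \<le> s" "s \<le> h" "0 \<le> t" "t \<le> h" for s t
    proof -
      have "norm (s *\<^sub>R x + t *\<^sub>R y) \<le> h * norm x + h * norm y"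
        using that by (intro norm_triangle_le add_mono) (auto intro: mult_right_mono)
      also have "\<dots> < h * (norm x + norm y + 1)" using h by (simp add: algebra_simps)
      also have "\<dots> = d" using np by (simp add: h_def)
      finally show ?thesis by (simp add: dist_norm add.assoc)
    qed
    have near': "dist (u + t *\<^sub>R y + s *\<^sub>R x) u < d" if "0 \<le> s" "s \<le> h" "0 \<le> t" "t \<le> h" for s t
      using near[OF that] by (simp add: add.assoc add.commute add.left_commute)
    have inU: "z \<in> U" if "dist z u < d" for z
      using that d0(2) by (auto simp: d_def dist_commute)
    obtain s t where st: "0 \<le> s" "s \<le> h" "0 \<le> t" "t \<le> h"
      "(f (u + h *\<^sub>R x + h *\<^sub>R y) - f (u + h *\<^sub>R x) - f (u + h *\<^sub>R y) + f u) \<bullet> a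
        = h * h * (Q x y (u + s *\<^sub>R x + t *\<^sub>R y) \<bullet> a)"
      using mixed_difference[OF U(1) f h inU[OF near], of a] unfolding Q_def by blast
    obtain s' t' where st': "0 \<le> s'" "s' \<le> h" "0 \<le> t'" "t' \<le> h"
      "(f (u + h *\<^sub>R y + h *\<^sub>R x) - f (u + h *\<^sub>R y) - f (u + h *\<^sub>R x) + f u) \<bullet> a
        = h * h * (Q y x (u + s' *\<^sub>R y + t' *\<^sub>R x) \<bullet> a)"
    proof -
      have "u + s *\<^sub>R y + t *\<^sub>R x \<in> U" if "0 \<le> s" "s \<le> h" "0 \<le> t" "t \<le> h" for s t
        using inU[OF near'[OF that(3,4,1,2)]] .
      from mixed_difference[OF U(1) f h this, of a] that show ?thesis unfolding Q_def by blast
    qed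
    have sym: "f (u + h *\<^sub>R y + h *\<^sub>R x) - f (u + h *\<^sub>R y) - f (u + h *\<^sub>R x) + f u =
      f (u + h *\<^sub>R x + h *\<^sub>R y) - f (u + h *\<^sub>R x) - f (u + h *\<^sub>R y) + f u"
      by (simp add: algebra_simps)
    have "h * h * (Q x y (u + s *\<^sub>R x + t *\<^sub>R y) \<bullet> a) = h * h * (Q y x (u + s' *\<^sub>R y + t' *\<^sub>R x) \<bullet> a)"
      using st(5) st'(5)[unfolded sym] by (simp only:)
    then have "Q x y (u + s *\<^sub>R x + t *\<^sub>R y) \<bullet> a = Q y x (u + s' *\<^sub>R y + t' *\<^sub>R x) \<bullet> a"
      using h by simp
    moreover have "dist (Q x y (u + s *\<^sub>R x + t *\<^sub>R y) \<bullet> a) (Q x y u \<bullet> a) < e"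
      using near[OF st(1-4)] by (intro d1(2)) (simp add: d_def)
    moreover have "dist (Q y x (u + s' *\<^sub>R y + t' *\<^sub>R x) \<bullet> a) (Q y x u \<bullet> a) < e"
      using near'[OF st'(3,4,1,2)] by (intro d2(2)) (simp add: d_def)
    ultimately show False unfolding e_def dist_real_def by (simp add: abs_if split: if_splits)
  qed
  then show ?thesis unfolding Q_def using inner_eq_zero_iff vector_eq_rdot by blast
qed

section \<open>Differentials in charts\<close>

lemma immersed_chart:
  assumes "immersed_submanifold A M" "(U, \<phi>) \<in> A"
  shows "open U" "inj_on \<phi> U" "C2_on U \<phi>" "\<And>u. u \<in> U \<Longrightarrow> inj (frechet_derivative \<phi> (at u))"
    "\<And>u. u \<in> U \<Longrightarrow> \<phi> u \<in> M"
  using assms unfolding immersed_submanifold_def by blast+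

lemma immersed_chart_exists:
  assumes "immersed_submanifold A M" "p \<in> M"
  obtains U \<phi> u where "(U, \<phi>) \<in> A" "u \<in> U" "\<phi> u = p"
  using assms unfolding immersed_submanifold_def by blast

lemma chart_differentiable:
  assumes "immersed_submanifold A M" "(U, \<phi>) \<in> A" "u \<in> U"
  shows "\<phi> differentiable (at u)" "linear (frechet_derivative \<phi> (at u))"
  using C2_on_differentiable[OF immersed_chart(3)[OF assms(1,2)] assms(3)] linear_frechet_derivative
  by blast+

lemma chart_derivative_C1:
  fixes A :: "('b::euclidean_space, 'm::euclidean_space) atlas"
  assumes "immersed_submanifold A M" "(U, \<phi>) \<in> A"
  shows "C1_on U (\<lambda>x. frechet_derivative \<phi> (at x) w)"
  using immersed_chart(1,3)[OF assms] C2_on_iff[of U \<phi>] by blast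

lemma C2_map_identity: "immersed_submanifold A M \<Longrightarrow> C2_map A A (\<lambda>p. p)"
  unfolding immersed_submanifold_def by blast

lemma local_composition:
  assumes "open W" "u \<in> W" "\<And>x. x \<in> W \<Longrightarrow> f x = g (h x)"
    and "h differentiable (at u)" "g differentiable (at (h u))"
  shows "f differentiable (at u)"
    "frechet_derivative f (at u) w = frechet_derivative g (at (h u)) (frechet_derivative h (at u) w)"
proof -
  have d: "(g \<circ> h) differentiable (at u)" by (rule frechet_derivative_comp(1)[OF assms(4,5)])
  have "(f has_derivative frechet_derivative (g \<circ> h) (at u)) (at u)"
    by (rule has_derivative_transform_within_open[OF has_derivative_frechet_derivative[OF d] assms(1,2)])
      (simp add: assms(3))
  then show "f differentiable (at u)"
    "frechet_derivative f (at u) w = frechet_derivative g (at (h u)) (frechet_derivative h (at u) w)"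
    using frechet_derivative_comp(2)[OF assms(4,5)] by (auto simp: frechet_derivative_eqI intro: differentiableI)
qed

lemma transition_map:
  assumes A: "immersed_submanifold A M" and c: "(U, \<phi>) \<in> A" "u \<in> U" "(V, \<psi>) \<in> A" "y \<in> V" "\<phi> u = \<psi> y"
  obtains h W where "open W" "u \<in> W" "C2_on W h" "h u = y" "\<And>x. x \<in> W \<Longrightarrow> \<phi> x = \<psi> (h x)"
proof
  let ?W = "{x \<in> U. \<phi> x \<in> \<psi> ` V}"
  let ?h = "inv_into V \<psi> \<circ> (\<lambda>p. p) \<circ> \<phi>"
  show "open ?W" "C2_on ?W ?h"
    using C2_map_identity[OF A] c(1,3) unfolding C2_map_def Let_def by fastforce+
  show "u \<in> ?W" using c by auto
  show "?h u = y" using c(4,5) immersed_chart(2)[OF A c(3)] by (simp add: inv_into_f_f)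
  show "\<phi> x = \<psi> (?h x)" if "x \<in> ?W" for x
    using that by (simp add: f_inv_into_f)
qed

text \<open>Injectivity of the chart derivative forces the transition map to carry \<open>w'\<close>
  to \<open>w\<close>; the rest is the chain rule. This is the chart independence behind
  \<open>mderiv\<close>.\<close>

lemma differentiable_other_chart:
  assumes A: "immersed_submanifold A M" and c: "(U, \<phi>) \<in> A" "u \<in> U" "(V, \<psi>) \<in> A" "y \<in> V" "\<phi> u = \<psi> y"
    and f: "(f \<circ> \<phi>) differentiable (at u)"
    and w: "frechet_derivative \<psi> (at y) w' = frechet_derivative \<phi> (at u) w"
  shows "frechet_derivative (f \<circ> \<psi>) (at y) w' = frechet_derivative (f \<circ> \<phi>) (at u) w"
proof -
  obtain k W where k: "open W" "y \<in> W" "C2_on W k" "k y = u" "\<And>x. x \<in> W \<Longrightarrow> \<psi> x = \<phi> (k x)"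
    using transition_map[OF A c(3,4,1,2) c(5)[symmetric]] by metis
  note dk = C2_on_differentiable[OF k(3,2)]
  have "frechet_derivative \<psi> (at y) w' = frechet_derivative \<phi> (at u) (frechet_derivative k (at y) w')"
    using local_composition(2)[where f=\<psi> and g=\<phi>, OF k(1,2,5) dk, of w'] chart_differentiable(1)[OF A c(1,2)] k(4) by simp
  then have "frechet_derivative k (at y) w' = w"
    using w immersed_chart(4)[OF A c(1,2)] by (simp add: inj_eq)
  moreover have "frechet_derivative (f \<circ> \<psi>) (at y) w' = frechet_derivative (f \<circ> \<phi>) (at u) (frechet_derivative k (at y) w')"
    using local_composition(2)[OF k(1,2) _ dk, of "f \<circ> \<psi>" "f \<circ> \<phi>" w'] k(4,5) f by simp
  ultimately show ?thesis by simp
qed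

text \<open>\<open>tangent_space\<close> collects vectors from all charts through the point; a
  transition map rewrites each of them in the one chosen chart.\<close>

lemma tangent_space_chart:
  assumes A: "immersed_submanifold A M" and c: "(U, \<phi>) \<in> A" "u \<in> U"
  shows "tangent_space A (\<phi> u) = range (frechet_derivative \<phi> (at u))"
proof
  show "range (frechet_derivative \<phi> (at u)) \<subseteq> tangent_space A (\<phi> u)"
    unfolding tangent_space_def using c by blast
  show "tangent_space A (\<phi> u) \<subseteq> range (frechet_derivative \<phi> (at u))"
  proof
    fix X assume "X \<in> tangent_space A (\<phi> u)"
    then obtain V \<psi> y w' where d: "(V, \<psi>) \<in> A" "y \<in> V" "\<psi> y = \<phi> u" and X: "X = frechet_derivative \<psi> (at y) w'"
      unfolding tangent_space_def by blast
    obtain k W where k: "open W" "y \<in> W" "C2_on W k" "k y = u" "\<And>x. x \<in> W \<Longrightarrow> \<psi> x = \<phi> (k x)"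
      using transition_map[OF A d(1,2) c d(3)] by metis
    have "X = frechet_derivative \<phi> (at u) (frechet_derivative k (at y) w')"
      using local_composition(2)[where f=\<psi> and g=\<phi>, OF k(1,2,5) C2_on_differentiable[OF k(3,2)], of w']
        chart_differentiable(1)[OF A c] k(4) X by simp
    then show "X \<in> range (frechet_derivative \<phi> (at u))" by blast
  qed
qed

lemma subspace_tangent_space:
  assumes "immersed_submanifold A M" "p \<in> M"
  shows "subspace (tangent_space A p)"
proof -
  obtain U \<phi> u where c: "(U, \<phi>) \<in> A" "u \<in> U" "\<phi> u = p" using immersed_chart_exists[OF assms] .
  show ?thesis
    using tangent_space_chart[OF assms(1) c(1,2)] c(3)
      linear_subspace_image[OF chart_differentiable(2)[OF assms(1) c(1,2)] subspace_UNIV] by simp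
qed

lemma dim_tangent_space:
  fixes A :: "('b::euclidean_space, 'm::euclidean_space) atlas"
  assumes "immersed_submanifold A M" "p \<in> M"
  shows "dim (tangent_space A p) = DIM('b)"
proof -
  obtain U \<phi> u where c: "(U, \<phi>) \<in> A" "u \<in> U" "\<phi> u = p" using immersed_chart_exists[OF assms] .
  show ?thesis
    using tangent_space_chart[OF assms(1) c(1,2)] c(3)
      dim_image_eq[OF chart_differentiable(2)[OF assms(1) c(1,2)], of UNIV] immersed_chart(4)[OF assms(1) c(1,2)]
    by (simp add: dim_UNIV)
qed

lemma mderiv_chart:
  assumes A: "immersed_submanifold A M" and c: "(U, \<phi>) \<in> A" "u \<in> U"
    and f: "(f \<circ> \<phi>) differentiable (at u)"
  shows "mderiv A f (\<phi> u) (frechet_derivative \<phi> (at u) w) = frechet_derivative (f \<circ> \<phi>) (at u) w"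
  unfolding mderiv_def
proof (rule the_equality)
  show "\<exists>V \<psi> y w'. (V, \<psi>) \<in> A \<and> y \<in> V \<and> \<psi> y = \<phi> u \<and> frechet_derivative \<psi> (at y) w' = frechet_derivative \<phi> (at u) w \<and>
     frechet_derivative (f \<circ> \<psi>) (at y) w' = frechet_derivative (f \<circ> \<phi>) (at u) w"
    using c by blast
next
  fix z assume "\<exists>V \<psi> y w'. (V, \<psi>) \<in> A \<and> y \<in> V \<and> \<psi> y = \<phi> u \<and> frechet_derivative \<psi> (at y) w' = frechet_derivative \<phi> (at u) w \<and>
     frechet_derivative (f \<circ> \<psi>) (at y) w' = z"
  then obtain V \<psi> y w' where d: "(V, \<psi>) \<in> A" "y \<in> V" "\<phi> u = \<psi> y"
    "frechet_derivative \<psi> (at y) w' = frechet_derivative \<phi> (at u) w"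
    "frechet_derivative (f \<circ> \<psi>) (at y) w' = z" by metis
  show "z = frechet_derivative (f \<circ> \<phi>) (at u) w"
    using differentiable_other_chart[OF A c d(1,2,3) f d(4)] d(5) by simp
qed

section \<open>Orthogonal projection to the tangent spaces\<close>

lemma tangential_eqI:
  assumes A: "immersed_submanifold A M" "p \<in> M"
    and y: "y \<in> tangent_space A p" "\<And>z. z \<in> tangent_space A p \<Longrightarrow> (x - y) \<bullet> z = 0"
  shows "tangential A p x = y"
  unfolding tangential_def
proof (rule the_equality)
  show "y \<in> tangent_space A p \<and> (\<forall>z\<in>tangent_space A p. (x - y) \<bullet> z = 0)" using y by blast
  fix y' assume y': "y' \<in> tangent_space A p \<and> (\<forall>z\<in>tangent_space A p. (x - y') \<bullet> z = 0)"
  have d: "y' - y \<in> tangent_space A p" using subspace_diff[OF subspace_tangent_space[OF A]] y y' by blast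
  have "(y' - y) \<bullet> (y' - y) = (x - y) \<bullet> (y' - y) - (x - y') \<bullet> (y' - y)"
    by (simp add: inner_diff_left)
  then have "(y' - y) \<bullet> (y' - y) = 0" using y(2)[OF d] y' d by simp
  then show "y' = y" by simp
qed

lemma tangential:
  fixes A :: "('b::euclidean_space, 'm::euclidean_space) atlas"
  assumes A: "immersed_submanifold A M" "p \<in> M"
  shows "tangential A p x \<in> tangent_space A p"
    "z \<in> tangent_space A p \<Longrightarrow> tangential A p x \<bullet> z = x \<bullet> z"
proof -
  have sp: "span (tangent_space A p) = tangent_space A p"
    using subspace_tangent_space[OF A] by (simp add: span_eq_iff)
  obtain y z where yz: "y \<in> tangent_space A p" "\<And>w. w \<in> tangent_space A p \<Longrightarrow> orthogonal z w" "x = y + z"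
    using orthogonal_subspace_decomp_exists[of "tangent_space A p" x] unfolding sp by metis
  have "tangential A p x = y"
    by (rule tangential_eqI[OF A yz(1)]) (use yz(2,3) in \<open>auto simp: orthogonal_def\<close>)
  then show "tangential A p x \<in> tangent_space A p"
    "w \<in> tangent_space A p \<Longrightarrow> tangential A p x \<bullet> w = x \<bullet> w" for w
    using yz by (auto simp: orthogonal_def inner_add_left)
qed

lemma tangential_zero:
  assumes A: "immersed_submanifold A M" "p \<in> M"
  shows "tangential A p 0 = 0"
  by (rule tangential_eqI[OF A]) (auto simp: subspace_0[OF subspace_tangent_space[OF A]])

text \<open>Asking only for one chart around each image point, instead of all charts as in \<open>C2_map\<close>,
  makes composition immediate.\<close>

definition locally_C2 ::
  "('b::real_normed_vector, 'm) atlas \<Rightarrow> ('c::real_normed_vector, 'p) atlas \<Rightarrow> ('m \<Rightarrow> 'p) \<Rightarrow> bool"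
where
  "locally_C2 A B F \<longleftrightarrow> (\<forall>U \<phi> u. (U, \<phi>) \<in> A \<longrightarrow> u \<in> U \<longrightarrow>
     (\<exists>V \<psi> h W. (V, \<psi>) \<in> B \<and> open W \<and> u \<in> W \<and> W \<subseteq> U \<and> C2_on W h \<and> h ` W \<subseteq> V \<and>
        (\<forall>x\<in>W. F (\<phi> x) = \<psi> (h x))))"

lemma locally_C2E:
  assumes "locally_C2 A B F" "(U, \<phi>) \<in> A" "u \<in> U"
  obtains V \<psi> h W where "(V, \<psi>) \<in> B" "open W" "u \<in> W" "W \<subseteq> U" "C2_on W h" "h ` W \<subseteq> V"
    "\<And>x. x \<in> W \<Longrightarrow> F (\<phi> x) = \<psi> (h x)"
  using assms unfolding locally_C2_def by metis

lemma locally_C2I: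
  assumes A: "immersed_submanifold A M" and B: "immersed_submanifold B N"
    and F: "C2_map A B F" and im: "\<And>p. p \<in> M \<Longrightarrow> F p \<in> N"
  shows "locally_C2 A B F"
  unfolding locally_C2_def
proof (intro allI impI)
  fix U \<phi> u assume c: "(U, \<phi>) \<in> A" "u \<in> U"
  obtain V \<psi> y where d: "(V, \<psi>) \<in> B" "y \<in> V" "\<psi> y = F (\<phi> u)"
    using immersed_chart_exists[OF B im[OF immersed_chart(5)[OF A c]]] .
  let ?W = "{x \<in> U. F (\<phi> x) \<in> \<psi> ` V}"
  let ?h = "inv_into V \<psi> \<circ> F \<circ> \<phi>"
  have "open ?W" "C2_on ?W ?h"
    using F c(1) d(1) unfolding C2_map_def Let_def by fastforce+
  moreover have "u \<in> ?W" "?W \<subseteq> U" using c d by (auto simp flip: d(3))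
  moreover have "?h ` ?W \<subseteq> V" by (auto intro: inv_into_into)
  moreover have "\<forall>x\<in>?W. F (\<phi> x) = \<psi> (?h x)" by (simp add: f_inv_into_f)
  ultimately show "\<exists>V \<psi> h W. (V, \<psi>) \<in> B \<and> open W \<and> u \<in> W \<and> W \<subseteq> U \<and> C2_on W h \<and> h ` W \<subseteq> V \<and>
        (\<forall>x\<in>W. F (\<phi> x) = \<psi> (h x))"
    using d(1) by (intro exI[of _ V] exI[of _ \<psi>] exI[of _ ?h] exI[of _ ?W]) (intro conjI)
qed

lemma locally_C2_compose:
  fixes A :: "('b::euclidean_space, 'm) atlas" and B :: "('c::euclidean_space, 'p) atlas"
    and C :: "('d::euclidean_space, 'q) atlas"
  assumes F: "locally_C2 A B F" and G: "locally_C2 B C G"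
  shows "locally_C2 A C (G \<circ> F)"
  unfolding locally_C2_def
proof (intro allI impI)
  fix U \<phi> u assume c: "(U, \<phi>) \<in> A" "u \<in> U"
  obtain V \<psi> h W where 1: "(V, \<psi>) \<in> B" "open W" "u \<in> W" "W \<subseteq> U" "C2_on W h" "h ` W \<subseteq> V"
    "\<And>x. x \<in> W \<Longrightarrow> F (\<phi> x) = \<psi> (h x)" using locally_C2E[OF F c] by metis
  have "h u \<in> V" using 1(3,6) by blast
  obtain X \<zeta> g Z where 2: "(X, \<zeta>) \<in> C" "open Z" "h u \<in> Z" "Z \<subseteq> V" "C2_on Z g" "g ` Z \<subseteq> X"
    "\<And>x. x \<in> Z \<Longrightarrow> G (\<psi> x) = \<zeta> (g x)" using locally_C2E[OF G 1(1) \<open>h u \<in> V\<close>] by metis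
  let ?W = "W \<inter> h -` Z"
  have o: "open ?W"
    using C1_on_continuous[OF C2_on_imp_C1_on[OF 1(5)]] 1(2) 2(2)
    by (metis continuous_on_open_vimage Int_commute)
  moreover have "C2_on ?W (g \<circ> h)"
    by (rule C2_on_compose[OF C2_on_subset[OF 1(5)] 2(5) _ o 2(2)]) auto
  moreover have "u \<in> ?W" "?W \<subseteq> U" "(g \<circ> h) ` ?W \<subseteq> X" using 1(3,4) 2(3,6) by auto
  moreover have "\<forall>x\<in>?W. (G \<circ> F) (\<phi> x) = \<zeta> ((g \<circ> h) x)" using 1(7) 2(7) by simp
  ultimately show "\<exists>V \<psi> h W. (V, \<psi>) \<in> C \<and> open W \<and> u \<in> W \<and> W \<subseteq> U \<and> C2_on W h \<and> h ` W \<subseteq> V \<and>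
        (\<forall>x\<in>W. (G \<circ> F) (\<phi> x) = \<psi> (h x))"
    using 2(1) by (intro exI[of _ X] exI[of _ \<zeta>] exI[of _ "g \<circ> h"] exI[of _ ?W]) (intro conjI)
qed

lemma C2_fun_compose:
  fixes A :: "('b::euclidean_space, 'm::euclidean_space) atlas" and B :: "('c::euclidean_space, 'p::euclidean_space) atlas"
    and g :: "'p \<Rightarrow> 'e::euclidean_space"
  assumes A: "immersed_submanifold A M" and B: "immersed_submanifold B N"
    and F: "locally_C2 A B F" and g: "C2_fun B g"
  shows "C2_fun A (g \<circ> F)"
  unfolding C2_fun_def
proof (intro ballI, clarify)
  fix U \<phi> assume c: "(U, \<phi>) \<in> A"
  show "C2_on U (g \<circ> F \<circ> \<phi>)"
  proof (rule C2_on_local[OF immersed_chart(1)[OF A c]])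
    fix u assume u: "u \<in> U"
    obtain V \<psi> h W where 1: "(V, \<psi>) \<in> B" "open W" "u \<in> W" "W \<subseteq> U" "C2_on W h" "h ` W \<subseteq> V"
      "\<And>x. x \<in> W \<Longrightarrow> F (\<phi> x) = \<psi> (h x)" using locally_C2E[OF F c u] by metis
    have "C2_on V (g \<circ> \<psi>)" using g 1(1) unfolding C2_fun_def by blast
    from C2_on_compose[OF 1(5) this 1(6,2) immersed_chart(1)[OF B 1(1)]]
    have "C2_on W (g \<circ> F \<circ> \<phi>)" by (rule C2_on_cong[OF 1(2), rotated]) (simp add: 1(7))
    then show "\<exists>W. open W \<and> u \<in> W \<and> C2_on W (g \<circ> F \<circ> \<phi>)" using 1 by blast
  qed
qed

lemma C2_fun_identity:
  assumes "immersed_submanifold A M"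
  shows "C2_fun A (\<lambda>p. p)"
  unfolding C2_fun_def using immersed_chart(3)[OF assms] by (auto simp: o_def)

lemma C2_fun_differentiable:
  assumes "C2_fun A g" "(U, \<phi>) \<in> A" "u \<in> U"
  shows "(g \<circ> \<phi>) differentiable (at u)"
  using assms C2_on_differentiable unfolding C2_fun_def by blast

text \<open>Near \<open>u\<close> the map \<open>F\<close> is \<psi> after some \<open>h\<close>,
  with \<psi> a chart of the target. Since the derivative of \<psi> is injective, a vector killed by
  the derivative of \<open>F \<circ> \<phi>\<close> is already killed by that of \<open>h\<close>.
  With \<open>g\<close> inverse to \<open>F\<close>, the last claim shows that a diffeomorphism has
  an injective differential.\<close>

lemma chain_rule:
  fixes A :: "('b::euclidean_space, 'm::euclidean_space) atlas" and B :: "('c::euclidean_space, 'p::euclidean_space) atlas"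
    and g :: "'p \<Rightarrow> 'e::euclidean_space"
  assumes B: "immersed_submanifold B N" and F: "locally_C2 A B F" and c: "(U, \<phi>) \<in> A" "u \<in> U"
    and g: "C2_fun B g"
  shows "(F \<circ> \<phi>) differentiable (at u)"
    and "frechet_derivative (F \<circ> \<phi>) (at u) w \<in> tangent_space B (F (\<phi> u))"
    and "mderiv B g (F (\<phi> u)) (frechet_derivative (F \<circ> \<phi>) (at u) w) = frechet_derivative (g \<circ> F \<circ> \<phi>) (at u) w"
    and "frechet_derivative (F \<circ> \<phi>) (at u) w = 0 \<Longrightarrow> frechet_derivative (g \<circ> F \<circ> \<phi>) (at u) w = 0"
proof -
  obtain V \<psi> h W where 1: "(V, \<psi>) \<in> B" "open W" "u \<in> W" "W \<subseteq> U" "C2_on W h" "h ` W \<subseteq> V"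
      "\<And>x. x \<in> W \<Longrightarrow> F (\<phi> x) = \<psi> (h x)" using locally_C2E[OF F c] by metis
  have y: "h u \<in> V" using 1(3,6) by blast
  note dh = C2_on_differentiable[OF 1(5,3)]
  note dpsi = chart_differentiable[OF B 1(1) y] and dg = C2_fun_differentiable[OF g 1(1) y]
  have a: "(F \<circ> \<phi>) differentiable (at u)" 
    "frechet_derivative (F \<circ> \<phi>) (at u) w = frechet_derivative \<psi> (at (h u)) (frechet_derivative h (at u) w)"
    using local_composition(1)[OF 1(2,3) _ dh dpsi(1), of "F \<circ> \<phi>"]
      local_composition(2)[OF 1(2,3) _ dh dpsi(1), of "F \<circ> \<phi>" w] 1(7) by simp_all
  have b: "frechet_derivative (g \<circ> F \<circ> \<phi>) (at u) w = frechet_derivative (g \<circ> \<psi>) (at (h u)) (frechet_derivative h (at u) w)"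
    using local_composition(2)[OF 1(2,3) _ dh dg, of "g \<circ> F \<circ> \<phi>" w] 1(7) by (simp add: o_def)
  have p: "F (\<phi> u) = \<psi> (h u)" by (rule 1(7)[OF 1(3)])
  show "(F \<circ> \<phi>) differentiable (at u)" by (rule a(1))
  show "frechet_derivative (F \<circ> \<phi>) (at u) w \<in> tangent_space B (F (\<phi> u))"
    unfolding a(2) p tangent_space_chart[OF B 1(1) y] by (rule rangeI)
  show "mderiv B g (F (\<phi> u)) (frechet_derivative (F \<circ> \<phi>) (at u) w) = frechet_derivative (g \<circ> F \<circ> \<phi>) (at u) w"
    unfolding a(2) b p by (rule mderiv_chart[OF B 1(1) y dg])
  assume "frechet_derivative (F \<circ> \<phi>) (at u) w = 0"
  then have "frechet_derivative h (at u) w = 0"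
    using a(2) linear_injective_0[OF dpsi(2)] immersed_chart(4)[OF B 1(1) y] by simp
  then show "frechet_derivative (g \<circ> F \<circ> \<phi>) (at u) w = 0"
    unfolding b using linear_0[OF linear_frechet_derivative[OF dg]] by simp
qed

text \<open>In coordinates the fields are \<open>L x\<close> and \<open>L y\<close>. Their ambient
  derivatives differ from tangent vectors by second derivatives of the chart, which are symmetric
  and cancel in the bracket. Tangency is what allows \<open>nabla_v\<close> to be applied to the
  bracket.\<close>

lemma lie_bracket_tangent:
  fixes A :: "('b::euclidean_space, 'm::euclidean_space) atlas"
  assumes A: "immersed_submanifold A M" and c: "(U, \<phi>) \<in> A" "u \<in> U"
    and X: "\<And>p. p \<in> M \<Longrightarrow> X p \<in> tangent_space A p" "(X \<circ> \<phi>) differentiable (at u)"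
    and Y: "\<And>p. p \<in> M \<Longrightarrow> Y p \<in> tangent_space A p" "(Y \<circ> \<phi>) differentiable (at u)"
  shows "lie_bracket A X Y (\<phi> u) \<in> tangent_space A (\<phi> u)"
proof -
  define L where "L z = frechet_derivative \<phi> (at z)" for z
  note U = immersed_chart(1)[OF A c(1)] c(2)
  have lin: "linear (L z)" if "z \<in> U" for z unfolding L_def by (rule chart_differentiable(2)[OF A c(1) that])
  have inj: "inj (L u)" unfolding L_def by (rule immersed_chart(4)[OF A c])
  have dL: "(\<lambda>z. L z b) differentiable (at u)" for b
    unfolding L_def by (rule C1_on_differentiable[OF chart_derivative_C1[OF A c(1)] c(2)])
  have sym: "frechet_derivative (\<lambda>z. L z a) (at u) b = frechet_derivative (\<lambda>z. L z b) (at u) a" for a b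
    unfolding L_def by (rule second_derivative_symmetric[OF U immersed_chart(3)[OF A c(1)]])
  have coord: "\<exists>x. \<forall>z\<in>U. L z (x z) = (X \<circ> \<phi>) z" if "\<And>p. p \<in> M \<Longrightarrow> X p \<in> tangent_space A p" for X
  proof (rule bchoice, rule ballI)
    fix z assume z: "z \<in> U"
    from that[OF immersed_chart(5)[OF A c(1) z]] show "\<exists>x. L z x = (X \<circ> \<phi>) z"
      unfolding tangent_space_chart[OF A c(1) z] L_def by auto
  qed
  obtain x where x: "\<And>z. z \<in> U \<Longrightarrow> L z (x z) = (X \<circ> \<phi>) z" using coord[OF X(1)] by blast
  obtain y where y: "\<And>z. z \<in> U \<Longrightarrow> L z (y z) = (Y \<circ> \<phi>) z" using coord[OF Y(1)] by blast
  \<comment> \<open>The product rule gives derivatives of the columns of \<open>L\<close> along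
    \<open>a\<close>, weighted by the coordinates \<open>z u\<close>. By symmetry this sum is one
    derivative of \<open>L x a\<close> along \<open>z u\<close>, a form in which the two fields can
    be compared.\<close>
  have D: "frechet_derivative (Z \<circ> \<phi>) (at u) a = L u (frechet_derivative z (at u) a) + frechet_derivative (\<lambda>x. L x a) (at u) (z u)"
    if z: "\<And>w. w \<in> U \<Longrightarrow> L w (z w) = (Z \<circ> \<phi>) w" and d: "(Z \<circ> \<phi>) differentiable (at u)" for Z z a
  proof -
    have dz: "z differentiable (at u)" by (rule differentiable_solution[OF U lin inj dL d z])
    show ?thesis
      using has_derivative_linear_application[OF U lin dL dz z, of a]
      unfolding sym[of _ a] linear_eq_sum_Basis[OF linear_frechet_derivative[OF dL], of a "z u", symmetric] .
  qed
  have "mderiv A Y (\<phi> u) (X (\<phi> u)) = frechet_derivative (Y \<circ> \<phi>) (at u) (x u)"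
    using mderiv_chart[OF A c Y(2), of "x u"] x[OF c(2)] by (simp add: L_def)
  moreover have "mderiv A X (\<phi> u) (Y (\<phi> u)) = frechet_derivative (X \<circ> \<phi>) (at u) (y u)"
    using mderiv_chart[OF A c X(2), of "y u"] y[OF c(2)] by (simp add: L_def)
  ultimately have "lie_bracket A X Y (\<phi> u) = L u (frechet_derivative y (at u) (x u)) - L u (frechet_derivative x (at u) (y u))"
    unfolding lie_bracket_def using D[OF x X(2), of "y u"] D[OF y Y(2), of "x u"] sym[of "x u" "y u"] by simp
  also have "\<dots> = L u (frechet_derivative y (at u) (x u) - frechet_derivative x (at u) (y u))"
    using linear_diff[OF lin[OF c(2)]] by simp
  finally show ?thesis unfolding tangent_space_chart[OF A c] L_def by simp
qed

section \<open>Curvature in a principal frame of a unit vector field\<close>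

lemma orthonormal_basis_some:
  fixes T :: "'m::euclidean_space set"
  assumes "subspace T"
  shows "orthonormal_basis T (SOME B. orthonormal_basis T B)"
proof -
  obtain B where "B \<subseteq> T" "pairwise orthogonal B" "\<And>x. x \<in> B \<Longrightarrow> norm x = 1" "span B = T"
    using orthonormal_basis_subspace[OF assms] by metis
  then have "orthonormal_basis T B" unfolding orthonormal_basis_def by blast
  then show ?thesis by (rule someI)
qed

lemma parseval:
  fixes x z :: "'m::euclidean_space"
  assumes "orthonormal_basis T B" "x \<in> T"
  shows "(\<Sum>e\<in>B. (e \<bullet> x) * (e \<bullet> z)) = x \<bullet> z"
proof -
  have B: "pairwise orthogonal B" "\<And>e. e \<in> B \<Longrightarrow> norm e = 1" "span B = T"
    using assms(1) unfolding orthonormal_basis_def by auto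
  have "finite B" using pairwise_orthogonal_imp_finite B(1) by blast
  then have "(\<Sum>e\<in>B. (x \<bullet> e) *\<^sub>R e) = x"
    using orthonormal_basis_expand[OF B(1,2)] B(3) assms(2) by blast
  then have "x \<bullet> z = (\<Sum>e\<in>B. (x \<bullet> e) *\<^sub>R e) \<bullet> z" by simp
  also have "\<dots> = (\<Sum>e\<in>B. (e \<bullet> x) * (e \<bullet> z))"
    unfolding inner_sum_left by (rule sum.cong[OF refl]) (simp add: inner_commute[of x])
  finally show ?thesis ..
qed

text \<open>The separate \<open>h\<close> allows an identity valid only on the chart domain, such as
  \<open>v \<bullet> v = 1\<close>, to be differentiated by taking \<open>h\<close>
  constant.\<close>

lemma frechet_derivative_inner:
  assumes "f differentiable (at u)" "g differentiable (at u)" "open U" "u \<in> U" "\<And>x. x \<in> U \<Longrightarrow> f x \<bullet> g x = h x"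
  shows "frechet_derivative h (at u) w = f u \<bullet> frechet_derivative g (at u) w + frechet_derivative f (at u) w \<bullet> g u"
    and "h differentiable (at u)"
proof -
  have "((\<lambda>x. f x \<bullet> g x) has_derivative (\<lambda>w. f u \<bullet> frechet_derivative g (at u) w + frechet_derivative f (at u) w \<bullet> g u)) (at u)"
    by (rule has_derivative_inner[OF has_derivative_frechet_derivative[OF assms(1)] has_derivative_frechet_derivative[OF assms(2)]])
  then have "(h has_derivative (\<lambda>w. f u \<bullet> frechet_derivative g (at u) w + frechet_derivative f (at u) w \<bullet> g u)) (at u)"
    by (rule has_derivative_transform_within_open[OF _ assms(3,4)]) (rule assms(5))
  then show "frechet_derivative h (at u) w = f u \<bullet> frechet_derivative g (at u) w + frechet_derivative f (at u) w \<bullet> g u"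
    and "h differentiable (at u)" by (simp_all add: frechet_derivative_eqI differentiableI)
qed

text \<open>The part of the situation that determines the curvature, freed from the lines and the
  other submanifolds. \<open>principal\<close> holds for every tangent \<open>X\<close>, so it gives
  all frame components of \<open>nabla A X v\<close>; the choice \<open>X = v\<close> makes
  \<open>v\<close> geodesic.\<close>

locale principal_frame =
  fixes A :: "('b::euclidean_space, 'm::euclidean_space) atlas" and M :: "'m set"
    and v :: "'m \<Rightarrow> 'm" and J :: "'i set" and E :: "'i \<Rightarrow> 'm \<Rightarrow> 'm" and lam :: "'i \<Rightarrow> 'm \<Rightarrow> real"
  assumes immersed: "immersed_submanifold A M"
    and unit: "unit_vector_field A M v"
    and finite_J: "finite J"
    and frame: "orthogonal_frame A M (perp A v) J E"
    and lam_differentiable: "\<And>j U \<phi> u. j \<in> J \<Longrightarrow> (U, \<phi>) \<in> A \<Longrightarrow> u \<in> U \<Longrightarrow> (lam j \<circ> \<phi>) differentiable (at u)"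
    and principal: "\<And>j p X. j \<in> J \<Longrightarrow> p \<in> M \<Longrightarrow> X \<in> tangent_space A p \<Longrightarrow>
      mderiv A v p X \<bullet> E j p = lam j p * (X \<bullet> E j p)"
begin

lemma v_tangent: "p \<in> M \<Longrightarrow> v p \<in> tangent_space A p"
  using unit unfolding unit_vector_field_def by blast

lemma v_unit: "p \<in> M \<Longrightarrow> v p \<bullet> v p = 1"
  using unit unfolding unit_vector_field_def norm_eq_1 by blast

lemma v_differentiable:
  assumes "(U, \<phi>) \<in> A" "u \<in> U"
  shows "(v \<circ> \<phi>) differentiable (at u)"
proof -
  have "C2_fun A v" using unit unfolding unit_vector_field_def by simp
  then show ?thesis using assms by (rule C2_fun_differentiable)
qed

lemma frame_at:
  assumes "p \<in> M"
  shows "span ((\<lambda>j. E j p) ` J) = perp A v p" "independent ((\<lambda>j. E j p) ` J)"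
    "\<And>i j. i \<in> J \<Longrightarrow> j \<in> J \<Longrightarrow> i \<noteq> j \<Longrightarrow> E i p \<bullet> E j p = 0"
proof -
  have "(\<forall>i\<in>J. \<forall>j\<in>J. i \<noteq> j \<longrightarrow> E i p \<bullet> E j p = 0) \<and> inj_on (\<lambda>j. E j p) J \<and>
     independent ((\<lambda>j. E j p) ` J) \<and> span ((\<lambda>j. E j p) ` J) = perp A v p"
    by (rule bspec[OF conjunct2[OF frame[unfolded orthogonal_frame_def]] assms])
  then show "span ((\<lambda>j. E j p) ` J) = perp A v p" "independent ((\<lambda>j. E j p) ` J)"
    "\<And>i j. i \<in> J \<Longrightarrow> j \<in> J \<Longrightarrow> i \<noteq> j \<Longrightarrow> E i p \<bullet> E j p = 0"
    by blast+
qed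

lemmas frame_span = frame_at(1) and frame_independent = frame_at(2)

lemma E_orthogonal: "i \<in> J \<Longrightarrow> j \<in> J \<Longrightarrow> i \<noteq> j \<Longrightarrow> p \<in> M \<Longrightarrow> E i p \<bullet> E j p = 0"
  by (rule frame_at(3))

lemma frame_C1: "j \<in> J \<Longrightarrow> C1_fun A (E j)"
  by (rule bspec[OF conjunct1[OF frame[unfolded orthogonal_frame_def]]])

lemma E_perp:
  assumes "j \<in> J" "p \<in> M"
  shows "E j p \<in> perp A v p"
  unfolding frame_span[OF assms(2), symmetric] using assms(1) by (intro span_base imageI)

lemma E_tangent: "j \<in> J \<Longrightarrow> p \<in> M \<Longrightarrow> E j p \<in> tangent_space A p"
  and E_v: "j \<in> J \<Longrightarrow> p \<in> M \<Longrightarrow> E j p \<bullet> v p = 0"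
  using E_perp[of j p] by (simp_all add: perp_def)

lemma v_E: "j \<in> J \<Longrightarrow> p \<in> M \<Longrightarrow> v p \<bullet> E j p = 0"
  by (subst inner_commute) (rule E_v)

lemma E_nonzero:
  assumes "j \<in> J" "p \<in> M"
  shows "E j p \<bullet> E j p \<noteq> 0"
proof
  assume "E j p \<bullet> E j p = 0"
  then have "0 \<in> (\<lambda>j. E j p) ` J" using assms(1) by force
  from dependent_zero[OF this] show False using frame_independent[OF assms(2)] by contradiction
qed

lemma E_differentiable:
  assumes "j \<in> J" "(U, \<phi>) \<in> A" "u \<in> U"
  shows "(E j \<circ> \<phi>) differentiable (at u)"
proof -
  have "C1_on U (E j \<circ> \<phi>)" using frame_C1[OF assms(1)] assms(2) unfolding C1_fun_def by auto
  then show ?thesis using assms(3) by (rule C1_on_differentiable)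
qed

lemma sum_inner_E:
  assumes "j \<in> J" "p \<in> M"
  shows "(\<Sum>l\<in>J. c l *\<^sub>R E l p) \<bullet> E j p = c j * (E j p \<bullet> E j p)"
proof -
  have "(\<Sum>l\<in>J. c l *\<^sub>R E l p) \<bullet> E j p = (\<Sum>l\<in>J. if l = j then c j * (E j p \<bullet> E j p) else 0)"
    unfolding inner_sum_left by (rule sum.cong[OF refl]) (use E_orthogonal assms in auto)
  then show ?thesis using finite_J assms(1) by simp
qed

text \<open>The remainder lies in the span of the frame and is orthogonal to every frame vector,
  hence it is zero.\<close>

lemma expansion:
  assumes p: "p \<in> M" and X: "X \<in> tangent_space A p"
  shows "X = (X \<bullet> v p) *\<^sub>R v p + (\<Sum>j\<in>J. ((X \<bullet> E j p) / (E j p \<bullet> E j p)) *\<^sub>R E j p)"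
proof -
  let ?s = "\<Sum>j\<in>J. ((X \<bullet> E j p) / (E j p \<bullet> E j p)) *\<^sub>R E j p"
  let ?Y = "X - (X \<bullet> v p) *\<^sub>R v p"
  let ?Z = "?Y - ?s"
  note sp = frame_span[OF p]
  have "?Y \<in> perp A v p"
    unfolding perp_def using X v_tangent[OF p] v_unit[OF p] subspace_tangent_space[OF immersed p]
    by (auto simp: inner_diff_left intro: subspace_diff subspace_scale)
  moreover have "?s \<in> perp A v p"
    unfolding sp[symmetric] by (intro span_sum span_scale span_base) auto
  ultimately have Z: "?Z \<in> span ((\<lambda>j. E j p) ` J)" unfolding sp[symmetric] by (rule span_diff)
  have "orthogonal ?Z w" if "w \<in> (\<lambda>j. E j p) ` J" for w
  proof -
    obtain j where j: "j \<in> J" "w = E j p" using \<open>w \<in> (\<lambda>j. E j p) ` J\<close> by blast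
    have "?Z \<bullet> E j p = X \<bullet> E j p - (X \<bullet> E j p) / (E j p \<bullet> E j p) * (E j p \<bullet> E j p)"
      using v_E[OF j(1) p] by (simp add: inner_diff_left sum_inner_E[OF j(1) p])
    then show ?thesis using E_nonzero[OF j(1) p] j(2) by (simp add: orthogonal_def)
  qed
  from orthogonal_to_span[OF Z this] have "?Z = 0" by (simp add: orthogonal_def)
  then have "?Y = ?s" by simp
  then have "X = ?s + (X \<bullet> v p) *\<^sub>R v p" by (rule iffD1[OF diff_eq_eq])
  then show ?thesis by (rule trans) (rule add.commute)
qed

text \<open>Turns the projection, which is defined by a description, into a formula whose
  differentiability in the base point is visible.\<close>

lemma tangential_expansion:
  assumes p: "p \<in> M"
  shows "tangential A p x = (x \<bullet> v p) *\<^sub>R v p + (\<Sum>j\<in>J. ((x \<bullet> E j p) / (E j p \<bullet> E j p)) *\<^sub>R E j p)"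
proof -
  have "(\<Sum>j\<in>J. ((tangential A p x \<bullet> E j p) / (E j p \<bullet> E j p)) *\<^sub>R E j p)
      = (\<Sum>j\<in>J. ((x \<bullet> E j p) / (E j p \<bullet> E j p)) *\<^sub>R E j p)"
    by (rule sum.cong[OF refl]) (simp add: tangential(2)[OF immersed p] E_tangent[OF _ p])
  then show ?thesis
    using expansion[OF p tangential(1)[OF immersed p, of x]] tangential(2)[OF immersed p v_tangent[OF p], of x]
    by simp
qed

lemma mderiv_v_v:
  assumes p: "p \<in> M" and X: "X \<in> tangent_space A p"
  shows "mderiv A v p X \<bullet> v p = 0"
proof -
  obtain U \<phi> u where c: "(U, \<phi>) \<in> A" "u \<in> U" "\<phi> u = p" using immersed_chart_exists[OF immersed p] .
  obtain x where x: "X = frechet_derivative \<phi> (at u) x"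
    using X tangent_space_chart[OF immersed c(1,2)] c(3) by auto
  have "frechet_derivative (\<lambda>x. 1::real) (at u) x = (v \<circ> \<phi>) u \<bullet> frechet_derivative (v \<circ> \<phi>) (at u) x + frechet_derivative (v \<circ> \<phi>) (at u) x \<bullet> (v \<circ> \<phi>) u"
    by (rule frechet_derivative_inner(1)[OF v_differentiable[OF c(1,2)] v_differentiable[OF c(1,2)] immersed_chart(1)[OF immersed c(1)] c(2)])
      (simp add: v_unit immersed_chart(5)[OF immersed c(1)])
  then show ?thesis
    using mderiv_chart[OF immersed c(1,2) v_differentiable[OF c(1,2)], of x] c(3) x by (simp add: inner_commute)
qed

text \<open>The derivative of \<open>v\<close> is absorbed into the eigenvalues, so the right-hand
  side can be differentiated again using one derivative of the frame, of \<open>lam\<close> and of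
  \<open>X\<close>.\<close>

lemma nabla_v:
  assumes p: "p \<in> M" and X: "X p \<in> tangent_space A p"
  shows "nabla A X v p = (\<Sum>j\<in>J. (lam j p * (X p \<bullet> E j p) / (E j p \<bullet> E j p)) *\<^sub>R E j p)"
  unfolding nabla_def tangential_expansion[OF p] mderiv_v_v[OF p X]
  by (simp add: principal[OF _ p X])

lemma nabla_v_v:
  assumes "p \<in> M"
  shows "nabla A v v p = 0"
  unfolding nabla_v[of p v, OF assms v_tangent[OF assms]] by (simp add: v_E assms)

lemma shape_operator_frame:
  assumes j: "j \<in> J" and p: "p \<in> M"
  shows "shape_operator A v p (E j p) = lam j p *\<^sub>R E j p"
proof -
  have "shape_operator A v p (E j p) = (\<Sum>l\<in>J. (lam l p * (E j p \<bullet> E l p) / (E l p \<bullet> E l p)) *\<^sub>R E l p)"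
    unfolding shape_operator_def by (rule nabla_v[where X = "\<lambda>_. E j p", OF p E_tangent[OF j p]])
  also have "\<dots> = (\<Sum>l\<in>J. if l = j then lam j p *\<^sub>R E j p else 0)"
    by (rule sum.cong[OF refl]) (use E_orthogonal[OF j _ _ p] E_nonzero[OF j p] in auto)
  also have "\<dots> = lam j p *\<^sub>R E j p" using finite_J j by simp
  finally show ?thesis .
qed

text \<open>The vector representing \<open>X \<mapsto> \<langle>R(X, v)v, E\<^sub>j\<rangle>\<close>. The derivative of \<open>X\<close> along \<open>v\<close> cancels between
  \<open>\<nabla>\<^sub>v \<nabla>\<^sub>X v\<close> and \<open>\<nabla>\<^bsub>[X,v]\<^esub> v\<close>.\<close>

definition curvature_form :: "'i \<Rightarrow> 'm \<Rightarrow> 'm" where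
  "curvature_form j p =
     (- (mderiv A (lam j) p (v p) + (lam j p)\<^sup>2)) *\<^sub>R E j p
     + (\<Sum>l\<in>J. (lam l p * (E l p \<bullet> mderiv A (E j) p (v p)) / (E l p \<bullet> E l p)) *\<^sub>R E l p)
     - lam j p *\<^sub>R mderiv A (E j) p (v p)"

text \<open>Each part differentiates along \<open>v\<close> an identity for
  \<open>Z = nabla A X v\<close>: \<open>Z \<bullet> v = 0\<close> for the first,
  \<open>Z \<bullet> E j = lam j * (X \<bullet> E j)\<close> for the second. The results depend on
  \<open>X\<close> only through \<open>X p\<close>, which is the tensoriality that
  \<open>ricci_frame\<close> relies on.\<close>

lemma riemann_frame:
  assumes p: "p \<in> M"
    and X: "\<And>q. q \<in> M \<Longrightarrow> X q \<in> tangent_space A q"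
    and dX: "\<And>U \<phi> u. (U, \<phi>) \<in> A \<Longrightarrow> u \<in> U \<Longrightarrow> (X \<circ> \<phi>) differentiable (at u)"
  shows "riemann A X v v p \<bullet> v p = 0"
    and "j \<in> J \<Longrightarrow> riemann A X v v p \<bullet> E j p = X p \<bullet> curvature_form j p"
proof -
  obtain U \<phi> u where c: "(U, \<phi>) \<in> A" "u \<in> U" "\<phi> u = p" using immersed_chart_exists[OF immersed p] .
  note oU = immersed_chart(1)[OF immersed c(1)] and inM = immersed_chart(5)[OF immersed c(1)]
  obtain e where e: "v p = frechet_derivative \<phi> (at u) e"
    using v_tangent[OF p] tangent_space_chart[OF immersed c(1,2)] c(3) by auto
  obtain x where x: "X p = frechet_derivative \<phi> (at u) x"
    using X[OF p] tangent_space_chart[OF immersed c(1,2)] c(3) by auto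
  define Z where "Z = nabla A X v"
  have Z: "Z q = (\<Sum>l\<in>J. (lam l q * (X q \<bullet> E l q) / (E l q \<bullet> E l q)) *\<^sub>R E l q)" if "q \<in> M" for q
    unfolding Z_def by (rule nabla_v[where X = X, OF that X[OF that]])
  have Zv: "Z q \<bullet> v q = 0" if "q \<in> M" for q
    unfolding Z[OF that] by (simp add: inner_sum_left E_v that)
  have ZE: "Z q \<bullet> E l q = lam l q * (X q \<bullet> E l q)" if "q \<in> M" "l \<in> J" for q l
    unfolding Z[OF that(1)] sum_inner_E[OF that(2,1)] using E_nonzero[OF that(2,1)] by simp
  note d = dX[OF c(1,2)] v_differentiable[OF c(1,2)]
  note dE = E_differentiable[OF _ c(1,2)] and dlam = lam_differentiable[OF _ c(1,2)]
  note mc = mderiv_chart[OF immersed c(1,2), unfolded c(3)]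
  have dZ: "(Z \<circ> \<phi>) differentiable (at u)"
  proof -
    have t: "(\<lambda>x. (lam l (\<phi> x) * (X (\<phi> x) \<bullet> E l (\<phi> x)) / (E l (\<phi> x) \<bullet> E l (\<phi> x))) *\<^sub>R E l (\<phi> x)) differentiable (at u)"
      if l: "l \<in> J" for l
    proof -
      have nz: "E l (\<phi> u) \<bullet> E l (\<phi> u) \<noteq> 0" using E_nonzero[OF l p] c(3) by simp
      show ?thesis
        by (intro differentiable_scaleR differentiable_divide differentiable_mult differentiable_inner nz
            d(1)[unfolded o_def] dE[OF l, unfolded o_def] dlam[OF l, unfolded o_def])
    qed
    have "(\<lambda>x. \<Sum>l\<in>J. (lam l (\<phi> x) * (X (\<phi> x) \<bullet> E l (\<phi> x)) / (E l (\<phi> x) \<bullet> E l (\<phi> x))) *\<^sub>R E l (\<phi> x)) differentiable (at u)"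
      using t finite_J by (intro differentiable_sum) auto
    then obtain D where "((\<lambda>x. \<Sum>l\<in>J. (lam l (\<phi> x) * (X (\<phi> x) \<bullet> E l (\<phi> x)) / (E l (\<phi> x) \<bullet> E l (\<phi> x))) *\<^sub>R E l (\<phi> x)) has_derivative D) (at u)"
      unfolding differentiable_def by blast
    then have "(Z \<circ> \<phi> has_derivative D) (at u)"
      by (rule has_derivative_transform_within_open[OF _ oU c(2)]) (simp add: Z inM)
    then show ?thesis by (rule differentiableI)
  qed
  have DZ: "mderiv A Z p (v p) = frechet_derivative (Z \<circ> \<phi>) (at u) e" using mc[OF dZ, of e] e by simp
  have DX: "mderiv A X p (v p) = frechet_derivative (X \<circ> \<phi>) (at u) e" using mc[OF d(1), of e] e by simp
  have Dv: "mderiv A v p (v p) = frechet_derivative (v \<circ> \<phi>) (at u) e" using mc[OF d(2), of e] e by simp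
  have DE: "mderiv A (E j) p (v p) = frechet_derivative (E j \<circ> \<phi>) (at u) e" if "j \<in> J" for j
    using mc[OF dE[OF that], of e] e by simp
  have Dlam: "mderiv A (lam j) p (v p) = frechet_derivative (lam j \<circ> \<phi>) (at u) e" if "j \<in> J" for j
    using mc[OF dlam[OF that], of e] e by simp
  have B: "lie_bracket A X v p \<in> tangent_space A p"
    using lie_bracket_tangent[OF immersed c(1,2) X d(1) v_tangent d(2)] c(3) by simp
  \<comment> \<open>\<open>nabla A v v\<close> vanishes on all of \<open>M\<close>, not only at
    \<open>p\<close>, so its derivative vanishes too.\<close>
  have W: "nabla A X (nabla A v v) p = 0"
  proof -
    have h0: "((nabla A v v \<circ> \<phi>) has_derivative (\<lambda>w. 0)) (at u)"
      by (rule has_derivative_transform_within_open[OF has_derivative_const[of "0::'m"] oU c(2)]) (simp add: nabla_v_v inM)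
    then have "mderiv A (nabla A v v) p (X p) = 0"
      using mc[OF differentiableI[OF h0], of x] x by (simp add: frechet_derivative_eqI[OF h0])
    then show ?thesis by (simp add: nabla_def[of A X] tangential_zero[OF immersed p])
  qed
  have R: "riemann A X v v p = - tangential A p (mderiv A Z p (v p)) - nabla A (lie_bracket A X v) v p"
    unfolding riemann_def W Z_def[symmetric] by (simp add: nabla_def[of A v Z])
  have nB: "nabla A (lie_bracket A X v) v p =
     (\<Sum>j\<in>J. (lam j p * (lie_bracket A X v p \<bullet> E j p) / (E j p \<bullet> E j p)) *\<^sub>R E j p)"
    by (rule nabla_v[where X = "lie_bracket A X v", OF p B])
  have nB_E: "nabla A (lie_bracket A X v) v p \<bullet> E j p = lam j p * (lie_bracket A X v p \<bullet> E j p)" if "j \<in> J" for j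
    unfolding nB sum_inner_E[OF that p] using E_nonzero[OF that p] by simp
  have nB_v: "nabla A (lie_bracket A X v) v p \<bullet> v p = 0"
    unfolding nB by (simp add: inner_sum_left E_v p)
  show "riemann A X v v p \<bullet> v p = 0"
  proof -
    have "frechet_derivative (\<lambda>x. 0::real) (at u) e = (Z \<circ> \<phi>) u \<bullet> frechet_derivative (v \<circ> \<phi>) (at u) e + frechet_derivative (Z \<circ> \<phi>) (at u) e \<bullet> (v \<circ> \<phi>) u"
      by (rule frechet_derivative_inner(1)[OF dZ d(2) oU c(2)]) (simp add: Zv inM)
    then have "mderiv A Z p (v p) \<bullet> v p = - (Z p \<bullet> mderiv A v p (v p))"
      unfolding DZ Dv by (simp add: c(3))
    \<comment> \<open>\<open>Z p\<close> is a combination of frame vectors, and by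
      \<open>principal\<close> the derivative of \<open>v\<close> along \<open>v\<close> is
      orthogonal to each of them.\<close>
    also have "Z p \<bullet> mderiv A v p (v p) = 0"
      unfolding Z[OF p] inner_sum_left
      by (rule sum.neutral) (simp add: inner_commute[of _ "mderiv A v p (v p)"] principal[OF _ p v_tangent[OF p]] v_E p)
    finally show ?thesis
      unfolding R by (simp add: inner_diff_left tangential(2)[OF immersed p v_tangent[OF p]] nB_v)
  qed
  show "riemann A X v v p \<bullet> E j p = X p \<bullet> curvature_form j p" if j: "j \<in> J"
  proof -
    have dXE: "(\<lambda>y. (X \<circ> \<phi>) y \<bullet> (E j \<circ> \<phi>) y) differentiable (at u)"
      by (rule frechet_derivative_inner(2)[OF d(1) dE[OF j] oU c(2)]) simp
    have XE: "frechet_derivative (\<lambda>y. (X \<circ> \<phi>) y \<bullet> (E j \<circ> \<phi>) y) (at u) e =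
       X p \<bullet> mderiv A (E j) p (v p) + mderiv A X p (v p) \<bullet> E j p"
      using frechet_derivative_inner(1)[OF d(1) dE[OF j] oU c(2) refl, of e] by (simp add: DX DE j c(3))
    have F1: "frechet_derivative (\<lambda>y. (Z \<circ> \<phi>) y \<bullet> (E j \<circ> \<phi>) y) (at u) e =
       (lam j \<circ> \<phi>) u \<bullet> frechet_derivative (\<lambda>y. (X \<circ> \<phi>) y \<bullet> (E j \<circ> \<phi>) y) (at u) e
       + frechet_derivative (lam j \<circ> \<phi>) (at u) e \<bullet> ((X \<circ> \<phi>) u \<bullet> (E j \<circ> \<phi>) u)"
      by (rule frechet_derivative_inner(1)[OF dlam[OF j] dXE oU c(2)]) (simp add: ZE inM j)
    have F2: "frechet_derivative (\<lambda>y. (Z \<circ> \<phi>) y \<bullet> (E j \<circ> \<phi>) y) (at u) e =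
       Z p \<bullet> mderiv A (E j) p (v p) + mderiv A Z p (v p) \<bullet> E j p"
      using frechet_derivative_inner(1)[OF dZ dE[OF j] oU c(2) refl, of e] by (simp add: DZ DE j c(3))
    have 1: "mderiv A Z p (v p) \<bullet> E j p =
       lam j p * (X p \<bullet> mderiv A (E j) p (v p) + mderiv A X p (v p) \<bullet> E j p)
       + mderiv A (lam j) p (v p) * (X p \<bullet> E j p) - Z p \<bullet> mderiv A (E j) p (v p)"
    proof -
      have "Z p \<bullet> mderiv A (E j) p (v p) + mderiv A Z p (v p) \<bullet> E j p =
        lam j p * (X p \<bullet> mderiv A (E j) p (v p) + mderiv A X p (v p) \<bullet> E j p)
        + mderiv A (lam j) p (v p) * (X p \<bullet> E j p)"
        using F1[unfolded F2 XE Dlam[OF j, symmetric]] by (simp only: o_apply c(3) inner_real_def)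
      then show ?thesis by linarith
    qed
    \<comment> \<open>Multiplied by \<open>lam j\<close>, the first term becomes the quadratic term
      of the Riccati equation, and the second cancels the derivative of \<open>X\<close> in
      \<open>1\<close>.\<close>
    have 2: "lie_bracket A X v p \<bullet> E j p = lam j p * (X p \<bullet> E j p) - mderiv A X p (v p) \<bullet> E j p"
      unfolding lie_bracket_def inner_diff_left principal[OF j p X[OF p]] ..
    have 3: "Z p \<bullet> mderiv A (E j) p (v p) =
        X p \<bullet> (\<Sum>l\<in>J. (lam l p * (E l p \<bullet> mderiv A (E j) p (v p)) / (E l p \<bullet> E l p)) *\<^sub>R E l p)"
      unfolding Z[OF p] inner_sum_left inner_sum_right by (rule sum.cong[OF refl]) simp
    have "riemann A X v v p \<bullet> E j p = - (mderiv A Z p (v p) \<bullet> E j p) - lam j p * (lie_bracket A X v p \<bullet> E j p)"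
      unfolding R by (simp add: inner_diff_left tangential(2)[OF immersed p E_tangent[OF j p]] nB_E j)
    also have "\<dots> = - (mderiv A (lam j) p (v p) + (lam j p)\<^sup>2) * (X p \<bullet> E j p)
       + Z p \<bullet> mderiv A (E j) p (v p) - lam j p * (X p \<bullet> mderiv A (E j) p (v p))"
      unfolding 1 2 power2_eq_square by algebra
    also have "\<dots> = X p \<bullet> curvature_form j p"
      unfolding curvature_form_def 3 inner_diff_right inner_add_right inner_scaleR_right ..
    finally show ?thesis .
  qed
qed

text \<open>On \<open>E j\<close> itself the derivative of the frame cancels: by orthogonality only
  the summand \<open>l = j\<close> survives, and it equals the last term. So it does not matter how
  the frame turns along \<open>v\<close>.\<close>

lemma E_curvature_form:
  assumes j: "j \<in> J" and p: "p \<in> M"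
  shows "E j p \<bullet> curvature_form j p = - (mderiv A (lam j) p (v p) + (lam j p)\<^sup>2) * (E j p \<bullet> E j p)"
proof -
  have "E j p \<bullet> (\<Sum>l\<in>J. (lam l p * (E l p \<bullet> mderiv A (E j) p (v p)) / (E l p \<bullet> E l p)) *\<^sub>R E l p)
      = lam j p * (E j p \<bullet> mderiv A (E j) p (v p))"
    unfolding inner_commute[of "E j p" "sum _ _"] sum_inner_E[OF j p] using E_nonzero[OF j p] by simp
  then show ?thesis
    unfolding curvature_form_def by (simp add: inner_diff_right inner_add_right algebra_simps)
qed

lemma sectional_curvature_frame:
  assumes j: "j \<in> J" and p: "p \<in> M"
  shows "sectional_curvature A v (E j) p = - (mderiv A (lam j) p (v p) + (lam j p)\<^sup>2)"
proof -
  have "riemann A (E j) v v p \<bullet> E j p = E j p \<bullet> curvature_form j p"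
    by (rule riemann_frame(2)[OF p E_tangent[OF j] E_differentiable[OF j] j])
  then show ?thesis
    unfolding sectional_curvature_def E_curvature_form[OF j p]
    using E_nonzero[OF j p] by (simp add: v_unit p v_E j)
qed

text \<open>Each \<open>e\<close> of the chosen basis is expanded in the frame. Summing over
  \<open>e\<close> first, \<open>parseval\<close> yields
  \<open>E j p \<bullet> curvature_form j p\<close>, in which the basis no longer appears.\<close>

lemma ricci_frame:
  assumes p: "p \<in> M"
  shows "ricci A v v p = (\<Sum>j\<in>J. sectional_curvature A v (E j) p)"
proof -
  define B where "B = (SOME B. orthonormal_basis (tangent_space A p) B)"
  have B: "orthonormal_basis (tangent_space A p) B"
    unfolding B_def by (rule orthonormal_basis_some[OF subspace_tangent_space[OF immersed p]])
  \<comment> \<open>\<open>riemann_frame\<close> asks for a differentiable field; the projection of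
    the constant vector \<open>e\<close> is one by its frame expansion.\<close>
  have diff: "((\<lambda>q. tangential A q e) \<circ> \<phi>) differentiable (at u)" if c: "(U, \<phi>) \<in> A" "u \<in> U" for U \<phi> u e
  proof -
    note inM = immersed_chart(5)[OF immersed c(1)]
    have vd: "(\<lambda>x. v (\<phi> x)) differentiable (at u)" using v_differentiable[OF c] by (simp add: o_def)
    have t: "(\<lambda>x. ((e \<bullet> E j (\<phi> x)) / (E j (\<phi> x) \<bullet> E j (\<phi> x))) *\<^sub>R E j (\<phi> x)) differentiable (at u)" if j: "j \<in> J" for j
      using E_differentiable[OF j c, unfolded o_def] E_nonzero[OF j inM[OF c(2)]]
      by (intro differentiable_scaleR differentiable_divide differentiable_inner differentiable_const)
    have "(\<lambda>x. (e \<bullet> v (\<phi> x)) *\<^sub>R v (\<phi> x) + (\<Sum>j\<in>J. ((e \<bullet> E j (\<phi> x)) / (E j (\<phi> x) \<bullet> E j (\<phi> x))) *\<^sub>R E j (\<phi> x))) differentiable (at u)"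
      using vd t finite_J by (intro differentiable_add differentiable_sum differentiable_scaleR differentiable_inner differentiable_const) auto
    then obtain D where "((\<lambda>x. (e \<bullet> v (\<phi> x)) *\<^sub>R v (\<phi> x) + (\<Sum>j\<in>J. ((e \<bullet> E j (\<phi> x)) / (E j (\<phi> x) \<bullet> E j (\<phi> x))) *\<^sub>R E j (\<phi> x))) has_derivative D) (at u)"
      unfolding differentiable_def by blast
    then have "(((\<lambda>q. tangential A q e) \<circ> \<phi>) has_derivative D) (at u)"
      by (rule has_derivative_transform_within_open[OF _ immersed_chart(1)[OF immersed c(1)] c(2)])
        (simp add: tangential_expansion inM)
    then show ?thesis by (rule differentiableI)
  qed
  have "riemann A (\<lambda>q. tangential A q e) v v p \<bullet> e =
      (\<Sum>j\<in>J. (e \<bullet> E j p) * (e \<bullet> curvature_form j p) / (E j p \<bullet> E j p))" if e: "e \<in> B" for e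
  proof -
    let ?R = "riemann A (\<lambda>q. tangential A q e) v v p"
    have eT: "e \<in> tangent_space A p" using B e span_base unfolding orthonormal_basis_def by blast
    have te: "tangential A p e = e" by (rule tangential_eqI[OF immersed p eT]) simp
    note r = riemann_frame[of p "\<lambda>q. tangential A q e", OF p tangential(1)[OF immersed] diff, unfolded te]
    have "?R \<bullet> e = ?R \<bullet> ((e \<bullet> v p) *\<^sub>R v p + (\<Sum>j\<in>J. ((e \<bullet> E j p) / (E j p \<bullet> E j p)) *\<^sub>R E j p))"
      using expansion[OF p eT] by simp
    also have "\<dots> = (\<Sum>j\<in>J. (e \<bullet> E j p) / (E j p \<bullet> E j p) * (?R \<bullet> E j p))"
      by (simp add: inner_add_right inner_sum_right r(1))
    also have "\<dots> = (\<Sum>j\<in>J. (e \<bullet> E j p) * (e \<bullet> curvature_form j p) / (E j p \<bullet> E j p))"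
      by (rule sum.cong[OF refl]) (simp add: r(2))
    finally show ?thesis .
  qed
  then have "ricci A v v p = (\<Sum>e\<in>B. \<Sum>j\<in>J. (e \<bullet> E j p) * (e \<bullet> curvature_form j p) / (E j p \<bullet> E j p))"
    unfolding ricci_def B_def[symmetric] by (rule sum.cong[OF refl])
  also have "\<dots> = (\<Sum>j\<in>J. (\<Sum>e\<in>B. (e \<bullet> E j p) * (e \<bullet> curvature_form j p)) / (E j p \<bullet> E j p))"
    by (subst sum.swap) (simp add: sum_divide_distrib)
  also have "\<dots> = (\<Sum>j\<in>J. sectional_curvature A v (E j) p)"
    by (rule sum.cong[OF refl])
      (simp only: parseval[OF B E_tangent[OF _ p]] E_curvature_form[OF _ p] sectional_curvature_frame[OF _ p]
        nonzero_mult_div_cancel_right[OF E_nonzero[OF _ p]])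
  finally show ?thesis .
qed

end

section \<open>Submanifolds with the same oriented lines\<close>

text \<open>\<open>theta\<close> is linear in the base point, so its exterior derivative has
  constant coefficients: it is, up to sign, the standard symplectic form of the product
  space.\<close>

lemma ext_deriv_theta:
  fixes X Y :: "'m::real_inner \<times> 'm"
  shows "ext_deriv theta z X Y = fst Y \<bullet> snd X - fst X \<bullet> snd Y"
proof -
  have "((\<lambda>z. theta z W) has_derivative (\<lambda>h. fst W \<bullet> snd h)) (at z)" for W :: "'m \<times> 'm"
    unfolding theta_def by (auto intro!: derivative_eq_intros)
  then have "frechet_derivative (\<lambda>z. theta z W) (at z) = (\<lambda>h. fst W \<bullet> snd h)" for W :: "'m \<times> 'm"
    by (rule frechet_derivative_eqI)
  then show ?thesis unfolding ext_deriv_def by simp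
qed

locale common_lines =
  fixes k :: nat
    and S :: "nat \<Rightarrow> 'a::euclidean_space set"
    and A :: "nat \<Rightarrow> ('b::euclidean_space, 'a) atlas"
    and v :: "nat \<Rightarrow> 'a \<Rightarrow> 'a"
    and \<Gamma> :: "('a \<times> 'a) set"
    and G :: "('b, 'a \<times> 'a) atlas"
  assumes dim: "DIM('b) = k"
    and submanifold: "\<And>i. i \<in> {1..k} \<Longrightarrow> immersed_submanifold (A i) (S i)"
    and unit_field: "\<And>i. i \<in> {1..k} \<Longrightarrow> unit_vector_field (A i) (S i) (v i)"
    and lines: "immersed_submanifold G \<Gamma>"
    and diffeo: "\<And>i. i \<in> {1..k} \<Longrightarrow> diffeomorphism (A i) (S i) G \<Gamma> (Phi (v i))"
    and isotropic: "isotropic G \<Gamma>"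
    and nonzero: "\<And>i j q. i \<in> {1..k} \<Longrightarrow> j \<in> {1..k} \<Longrightarrow> i \<noteq> j \<Longrightarrow> q \<in> S i \<Longrightarrow>
                    signed_dist S v i j q \<noteq> 0"
begin

declare One_nat_def [simp del]

lemma one_in: "1 \<in> {1..k}"
  using dim DIM_positive[where 'a='b] by simp

lemma field_tangent:
  assumes "i \<in> {1..k}" "p \<in> S i"
  shows "v i p \<in> tangent_space (A i) p" "norm (v i p) = 1" "v i p \<bullet> v i p = 1"
  using unit_field[OF assms(1)] assms(2) unfolding unit_vector_field_def by (simp_all add: norm_eq_1)

lemma v_C2: "i \<in> {1..k} \<Longrightarrow> C2_fun (A i) (v i)"
  using unit_field unfolding unit_vector_field_def by blast

section \<open>Transfer maps and signed distances\<close>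

lemma Phi_bij: "i \<in> {1..k} \<Longrightarrow> bij_betw (Phi (v i)) (S i) \<Gamma>"
  using diffeo unfolding diffeomorphism_def by blast

lemma Phi_locally_C2: "i \<in> {1..k} \<Longrightarrow> locally_C2 (A i) G (Phi (v i))"
  using locally_C2I[OF submanifold lines] diffeo Phi_bij bij_betwE unfolding diffeomorphism_def by blast

lemma inv_Phi_locally_C2:
  assumes i: "i \<in> {1..k}"
  shows "locally_C2 G (A i) (inv_into (S i) (Phi (v i)))"
proof (rule locally_C2I[OF lines submanifold[OF i]])
  show "C2_map G (A i) (inv_into (S i) (Phi (v i)))" using diffeo[OF i] unfolding diffeomorphism_def by blast
  show "inv_into (S i) (Phi (v i)) p \<in> S i" if "p \<in> \<Gamma>" for p
    using that Phi_bij[OF i] by (metis bij_betw_imp_surj_on inv_into_into)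
qed

lemma transfer_locally_C2:
  "i \<in> {1..k} \<Longrightarrow> j \<in> {1..k} \<Longrightarrow> locally_C2 (A i) (A j) (transfer S v i j)"
  unfolding transfer_def by (rule locally_C2_compose[OF Phi_locally_C2 inv_Phi_locally_C2])

lemma transfer:
  assumes i: "i \<in> {1..k}" and j: "j \<in> {1..k}" and q: "q \<in> S i"
  shows "transfer S v i j q \<in> S j" "Phi (v j) (transfer S v i j q) = Phi (v i) q"
proof -
  have "Phi (v i) q \<in> Phi (v j) ` S j"
    using bij_betw_imp_surj_on[OF Phi_bij[OF i]] bij_betw_imp_surj_on[OF Phi_bij[OF j]] q by blast
  then show "transfer S v i j q \<in> S j" "Phi (v j) (transfer S v i j q) = Phi (v i) q"
    unfolding transfer_def by (simp_all add: inv_into_into f_inv_into_f)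
qed

lemma inv_Phi_eq:
  assumes "j \<in> {1..k}" "r \<in> S j" "Phi (v j) r = z"
  shows "inv_into (S j) (Phi (v j)) z = r"
  using inv_into_f_f[OF bij_betw_imp_inj_on[OF Phi_bij[OF assms(1)]] assms(2)] assms(3) by simp

lemma transfer_eqI:
  assumes "j \<in> {1..k}" "r \<in> S j" "Phi (v j) r = Phi (v i) q"
  shows "transfer S v i j q = r"
  unfolding transfer_def o_apply by (rule inv_Phi_eq[OF assms])

lemma transfer_inverse:
  assumes "i \<in> {1..k}" "j \<in> {1..k}" "q \<in> S i"
  shows "transfer S v j i (transfer S v i j q) = q"
  by (rule transfer_eqI[OF assms(1,3) transfer(2)[OF assms, symmetric]])

text \<open>Equal values of \<open>Phi\<close> mean equal directions and equal components orthogonal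
  to them. The two points therefore differ by a multiple of the direction, and
  \<open>signed_dist\<close> is that multiple.\<close>

lemma transfer_line:
  assumes "i \<in> {1..k}" "j \<in> {1..k}" "q \<in> S i"
  shows "v j (transfer S v i j q) = v i q"
    "transfer S v i j q = q - signed_dist S v i j q *\<^sub>R v i q"
proof -
  let ?r = "transfer S v i j q"
  show v: "v j ?r = v i q" using transfer(2)[OF assms] unfolding Phi_def by simp
  have "?r - (v i q \<bullet> ?r) *\<^sub>R v i q = q - (v i q \<bullet> q) *\<^sub>R v i q"
    using transfer(2)[OF assms] v unfolding Phi_def by simp
  then have "?r = q - (v i q \<bullet> q) *\<^sub>R v i q + (v i q \<bullet> ?r) *\<^sub>R v i q" by (rule iffD1[OF diff_eq_eq])
  also have "\<dots> = q - signed_dist S v i j q *\<^sub>R v i q"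
    unfolding signed_dist_def by (simp add: inner_diff_left inner_commute[of "v i q"] scaleR_diff_left)
  finally show "?r = q - signed_dist S v i j q *\<^sub>R v i q" .
qed

text \<open>Points of \<open>S j\<close> and \<open>S l\<close> at the same distance along the same
  line coincide, and at such a point the signed distance from \<open>S j\<close> to
  \<open>S l\<close> is zero, against \<open>nonzero\<close>.\<close>

lemma signed_dist_distinct:
  assumes i: "i \<in> {1..k}" and j: "j \<in> {1..k}" and l: "l \<in> {1..k}" "j \<noteq> l" and q: "q \<in> S i"
  shows "signed_dist S v i j q \<noteq> signed_dist S v i l q"
proof
  assume eq: "signed_dist S v i j q = signed_dist S v i l q"
  let ?r = "transfer S v i j q"
  have r: "transfer S v i l q = ?r" using transfer_line(2)[OF i j q] transfer_line(2)[OF i l(1) q] eq by simp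
  have "Phi (v l) ?r = Phi (v j) ?r" "?r \<in> S l"
    using transfer[OF i l(1) q] transfer(2)[OF i j q] unfolding r by simp_all
  then have "transfer S v j l ?r = ?r" by (intro transfer_eqI[OF l(1)])
  then have "signed_dist S v j l ?r = 0" unfolding signed_dist_def by simp
  then show False using nonzero[OF j l transfer(1)[OF i j q]] by simp
qed

section \<open>Differentials of the line map and of the transfers in a chart of
  \<open>S 1\<close>\<close>

lemma Phi_derivative:
  assumes c: "(U, \<phi>) \<in> A 1" "u \<in> U"
  shows "((Phi (v 1) \<circ> \<phi>) has_derivative
     (\<lambda>x. (frechet_derivative (v 1 \<circ> \<phi>) (at u) x,
       frechet_derivative \<phi> (at u) x - ((v 1 (\<phi> u) \<bullet> \<phi> u) *\<^sub>R frechet_derivative (v 1 \<circ> \<phi>) (at u) x +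
         (v 1 (\<phi> u) \<bullet> frechet_derivative \<phi> (at u) x + frechet_derivative (v 1 \<circ> \<phi>) (at u) x \<bullet> \<phi> u) *\<^sub>R v 1 (\<phi> u)))))
     (at u)"
proof -
  note dphi = has_derivative_frechet_derivative[OF chart_differentiable(1)[OF submanifold[OF one_in] c]]
  note dv = has_derivative_frechet_derivative[OF C2_fun_differentiable[OF v_C2[OF one_in] c]]
  from has_derivative_Pair[OF dv has_derivative_diff[OF dphi has_derivative_scaleR[OF has_derivative_inner[OF dv dphi] dv]]]
  show ?thesis unfolding Phi_def comp_def .
qed

lemma v_derivative_v:
  assumes c: "(U, \<phi>) \<in> A 1" "u \<in> U"
  shows "frechet_derivative (v 1 \<circ> \<phi>) (at u) x \<bullet> v 1 (\<phi> u) = 0"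
proof -
  note d = C2_fun_differentiable[OF v_C2[OF one_in] c]
  have "frechet_derivative (\<lambda>x. 1::real) (at u) x = (v 1 \<circ> \<phi>) u \<bullet> frechet_derivative (v 1 \<circ> \<phi>) (at u) x
      + frechet_derivative (v 1 \<circ> \<phi>) (at u) x \<bullet> (v 1 \<circ> \<phi>) u"
    by (rule frechet_derivative_inner(1)[OF d d immersed_chart(1)[OF submanifold[OF one_in] c(1)] c(2)])
      (simp add: field_tangent(3)[OF one_in] immersed_chart(5)[OF submanifold[OF one_in] c(1)])
  then show ?thesis by (simp add: inner_commute)
qed

text \<open>The isotropy of \<open>\<Gamma>\<close>, pulled back to the chart.\<close>

lemma derivative_symmetric:
  assumes c: "(U, \<phi>) \<in> A 1" "u \<in> U"
  shows "frechet_derivative \<phi> (at u) x \<bullet> frechet_derivative (v 1 \<circ> \<phi>) (at u) y =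
    frechet_derivative \<phi> (at u) y \<bullet> frechet_derivative (v 1 \<circ> \<phi>) (at u) x"
proof -
  let ?F = "frechet_derivative \<phi> (at u)" and ?N = "frechet_derivative (v 1 \<circ> \<phi>) (at u)"
  let ?D = "frechet_derivative (Phi (v 1) \<circ> \<phi>) (at u)" and ?p = "\<phi> u"
  have D: "?D x = (?N x, ?F x - ((v 1 ?p \<bullet> ?p) *\<^sub>R ?N x + (v 1 ?p \<bullet> ?F x + ?N x \<bullet> ?p) *\<^sub>R v 1 ?p))" for x
    unfolding frechet_derivative_eqI[OF Phi_derivative[OF c]] ..
  have p: "?p \<in> S 1" by (rule immersed_chart(5)[OF submanifold[OF one_in] c])
  have z: "Phi (v 1) ?p \<in> \<Gamma>" using bij_betw_imp_surj_on[OF Phi_bij[OF one_in]] p by blast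
  have T: "?D x \<in> tangent_space G (Phi (v 1) ?p)" for x
    by (rule chain_rule(2)[OF lines Phi_locally_C2[OF one_in] c C2_fun_identity[OF lines]])
  have "Omega (Phi (v 1) ?p) (?D x) (?D y) = 0"
    using isotropic z T unfolding isotropic_def by blast
  then have "?N y \<bullet> snd (?D x) = ?N x \<bullet> snd (?D y)"
    unfolding Omega_def ext_deriv_theta D by simp
  \<comment> \<open>The component along \<open>v 1\<close> drops out, since derivatives of a unit
    field are orthogonal to it; the remaining correction is symmetric in \<open>x\<close> and
    \<open>y\<close>.\<close>
  moreover have "?N y \<bullet> snd (?D x) = ?N y \<bullet> ?F x - (v 1 ?p \<bullet> ?p) * (?N y \<bullet> ?N x)" for x y
    unfolding D by (simp add: inner_diff_right inner_add_right v_derivative_v[OF c])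
  ultimately show ?thesis by (simp add: inner_commute)
qed

text \<open>Sliding a point along its own line while the direction stays fixed leaves the line
  unchanged to first order, so the differential of \<open>Phi (v 1)\<close> kills \<open>w\<close>.
  The smooth inverse of \<open>Phi (v 1)\<close> then forces \<open>w = 0\<close>.\<close>

lemma line_derivative_injective:
  assumes c: "(U, \<phi>) \<in> A 1" "u \<in> U"
    and w: "frechet_derivative (v 1 \<circ> \<phi>) (at u) w = 0" "frechet_derivative \<phi> (at u) w = a *\<^sub>R v 1 (\<phi> u)"
  shows "w = 0"
proof -
  note A = submanifold[OF one_in]
  let ?g = "inv_into (S 1) (Phi (v 1))"
  have "frechet_derivative (Phi (v 1) \<circ> \<phi>) (at u) w = 0"
    unfolding frechet_derivative_eqI[OF Phi_derivative[OF c]] w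
    by (simp add: field_tangent(3)[OF one_in immersed_chart(5)[OF A c]] zero_prod_def)
  moreover have "C2_fun G ?g"
    using C2_fun_compose[OF lines A inv_Phi_locally_C2[OF one_in] C2_fun_identity[OF A]] by (simp add: o_def)
  ultimately have 0: "frechet_derivative (?g \<circ> Phi (v 1) \<circ> \<phi>) (at u) w = 0"
    using chain_rule(4)[OF lines Phi_locally_C2[OF one_in] c] by blast
  have "(?g \<circ> Phi (v 1) \<circ> \<phi>) x = \<phi> x" if "x \<in> U" for x
    using inv_Phi_eq[OF one_in immersed_chart(5)[OF A c(1) that] refl] by simp
  then have "(?g \<circ> Phi (v 1) \<circ> \<phi> has_derivative frechet_derivative \<phi> (at u)) (at u)"
    by (intro has_derivative_transform_within_open[OF has_derivative_frechet_derivative[OF chart_differentiable(1)[OF A c]]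
          immersed_chart(1)[OF A c(1)] c(2)]) (rule sym)
  then have "frechet_derivative \<phi> (at u) w = 0" using 0 by (simp add: frechet_derivative_eqI)
  then show "w = 0"
    using linear_injective_0[OF chart_differentiable(2)[OF A c]] immersed_chart(4)[OF A c] by blast
qed

lemma transfer_C2_fun:
  assumes "i \<in> {1..k}" "j \<in> {1..k}"
  shows "C2_fun (A i) (transfer S v i j)"
  using C2_fun_compose[OF submanifold[OF assms(1)] submanifold[OF assms(2)] transfer_locally_C2[OF assms]
      C2_fun_identity[OF submanifold[OF assms(2)]]] by (simp add: o_def)

text \<open>The opposite transfer is an inverse, which gives injectivity and the pushforward
  formula. Both submanifolds have dimension \<open>DIM('b)\<close>, so an injective differential
  fills the tangent space of \<open>S j\<close>.\<close>

lemma transfer_derivative: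
  assumes c: "(U, \<phi>) \<in> A 1" "u \<in> U" and j: "j \<in> {1..k}"
  shows "inj (frechet_derivative (transfer S v 1 j \<circ> \<phi>) (at u))"
    and "range (frechet_derivative (transfer S v 1 j \<circ> \<phi>) (at u)) = tangent_space (A j) (transfer S v 1 j (\<phi> u))"
    and "mderiv (A j) (transfer S v j 1) (transfer S v 1 j (\<phi> u)) (frechet_derivative (transfer S v 1 j \<circ> \<phi>) (at u) w)
      = frechet_derivative \<phi> (at u) w"
proof -
  note A = submanifold[OF one_in] and B = submanifold[OF j]
  let ?D = "frechet_derivative (transfer S v 1 j \<circ> \<phi>) (at u)"
  note ch = chain_rule[OF B transfer_locally_C2[OF one_in j] c transfer_C2_fun[OF j one_in]]
  have "(transfer S v j 1 \<circ> transfer S v 1 j \<circ> \<phi>) x = \<phi> x" if "x \<in> U" for x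
    using transfer_inverse[OF one_in j immersed_chart(5)[OF A c(1) that]] by simp
  then have "(transfer S v j 1 \<circ> transfer S v 1 j \<circ> \<phi> has_derivative frechet_derivative \<phi> (at u)) (at u)"
    by (intro has_derivative_transform_within_open[OF has_derivative_frechet_derivative[OF chart_differentiable(1)[OF A c]]
          immersed_chart(1)[OF A c(1)] c(2)]) (rule sym)
  then have eq: "frechet_derivative (transfer S v j 1 \<circ> transfer S v 1 j \<circ> \<phi>) (at u) = frechet_derivative \<phi> (at u)"
    by (rule frechet_derivative_eqI)
  show "mderiv (A j) (transfer S v j 1) (transfer S v 1 j (\<phi> u)) (?D w) = frechet_derivative \<phi> (at u) w"
    using ch(3)[of w] unfolding eq .
  have lin: "linear ?D" by (rule linear_frechet_derivative[OF ch(1)])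
  show inj: "inj ?D"
    unfolding linear_injective_0[OF lin]
    using ch(4) linear_injective_0[OF chart_differentiable(2)[OF A c]] immersed_chart(4)[OF A c]
    unfolding eq by blast
  have r: "transfer S v 1 j (\<phi> u) \<in> S j" by (rule transfer(1)[OF one_in j immersed_chart(5)[OF A c]])
  show "range ?D = tangent_space (A j) (transfer S v 1 j (\<phi> u))"
  proof (rule subspace_dim_equal)
    show "subspace (range ?D)" by (rule linear_subspace_image[OF lin subspace_UNIV])
    show "subspace (tangent_space (A j) (transfer S v 1 j (\<phi> u)))" by (rule subspace_tangent_space[OF B r])
    show "range ?D \<subseteq> tangent_space (A j) (transfer S v 1 j (\<phi> u))" using ch(2) by blast
    show "dim (tangent_space (A j) (transfer S v 1 j (\<phi> u))) \<le> dim (range ?D)"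
      unfolding dim_tangent_space[OF B r] using dim_image_eq[OF lin, of UNIV] inj by (simp add: dim_UNIV)
  qed
qed

lemma signed_dist_differentiable:
  assumes c: "(U, \<phi>) \<in> A 1" "u \<in> U" and j: "j \<in> {1..k}"
  shows "(signed_dist S v 1 j \<circ> \<phi>) differentiable (at u)"
proof -
  have "(transfer S v 1 j \<circ> \<phi>) differentiable (at u)"
    by (rule C2_fun_differentiable[OF transfer_C2_fun[OF one_in j] c])
  moreover have "\<phi> differentiable (at u)" by (rule chart_differentiable(1)[OF submanifold[OF one_in] c])
  moreover have "(v 1 \<circ> \<phi>) differentiable (at u)" by (rule C2_fun_differentiable[OF v_C2[OF one_in] c])
  ultimately have "(\<lambda>x. (\<phi> x - transfer S v 1 j (\<phi> x)) \<bullet> v 1 (\<phi> x)) differentiable (at u)"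
    unfolding o_def by (intro differentiable_inner differentiable_diff)
  then show ?thesis unfolding signed_dist_def o_def .
qed

lemma transfer_derivative_eq:
  assumes c: "(U, \<phi>) \<in> A 1" "u \<in> U" and j: "j \<in> {1..k}"
  shows "frechet_derivative (transfer S v 1 j \<circ> \<phi>) (at u) x = frechet_derivative \<phi> (at u) x
    - (signed_dist S v 1 j (\<phi> u) *\<^sub>R frechet_derivative (v 1 \<circ> \<phi>) (at u) x
       + frechet_derivative (signed_dist S v 1 j \<circ> \<phi>) (at u) x *\<^sub>R v 1 (\<phi> u))"
proof -
  note A = submanifold[OF one_in]
  have "((\<lambda>x. \<phi> x - (signed_dist S v 1 j \<circ> \<phi>) x *\<^sub>R (v 1 \<circ> \<phi>) x) has_derivative
     (\<lambda>x. frechet_derivative \<phi> (at u) x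
    - ((signed_dist S v 1 j \<circ> \<phi>) u *\<^sub>R frechet_derivative (v 1 \<circ> \<phi>) (at u) x
       + frechet_derivative (signed_dist S v 1 j \<circ> \<phi>) (at u) x *\<^sub>R (v 1 \<circ> \<phi>) u))) (at u)"
    by (intro has_derivative_diff has_derivative_scaleR has_derivative_frechet_derivative
        chart_differentiable(1)[OF A c] signed_dist_differentiable[OF c j] C2_fun_differentiable[OF v_C2[OF one_in] c])
  then have "((transfer S v 1 j \<circ> \<phi>) has_derivative
     (\<lambda>x. frechet_derivative \<phi> (at u) x
    - ((signed_dist S v 1 j \<circ> \<phi>) u *\<^sub>R frechet_derivative (v 1 \<circ> \<phi>) (at u) x
       + frechet_derivative (signed_dist S v 1 j \<circ> \<phi>) (at u) x *\<^sub>R (v 1 \<circ> \<phi>) u))) (at u)"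
  proof (rule has_derivative_transform_within_open[OF _ immersed_chart(1)[OF A c(1)] c(2)])
    fix x assume "x \<in> U"
    from transfer_line(2)[OF one_in j immersed_chart(5)[OF A c(1) this]]
    show "\<phi> x - (signed_dist S v 1 j \<circ> \<phi>) x *\<^sub>R (v 1 \<circ> \<phi>) x = (transfer S v 1 j \<circ> \<phi>) x" by simp
  qed
  from frechet_derivative_eqI[OF this] show ?thesis by simp
qed

text \<open>\<open>v 1 (\<phi> u)\<close> is also the value of \<open>v j\<close> at the transferred
  point, hence tangent to \<open>S j\<close> and in the range of the differential.\<close>

lemma direction:
  assumes c: "(U, \<phi>) \<in> A 1" "u \<in> U" and j: "j \<in> {1..k}"
  obtains e where "frechet_derivative (transfer S v 1 j \<circ> \<phi>) (at u) e = v 1 (\<phi> u)"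
proof -
  have p: "\<phi> u \<in> S 1" by (rule immersed_chart(5)[OF submanifold[OF one_in] c])
  have "v 1 (\<phi> u) \<in> range (frechet_derivative (transfer S v 1 j \<circ> \<phi>) (at u))"
    unfolding transfer_derivative(2)[OF c j]
    using field_tangent(1)[OF j transfer(1)[OF one_in j p]] unfolding transfer_line(1)[OF one_in j p] .
  then show ?thesis using that by (metis imageE)
qed

lemma Efield_chart:
  assumes c: "(U, \<phi>) \<in> A 1" "u \<in> U" and j: "j \<in> {1..k}"
    and e: "frechet_derivative (transfer S v 1 j \<circ> \<phi>) (at u) e = v 1 (\<phi> u)"
  defines "F \<equiv> frechet_derivative \<phi> (at u)" and "N \<equiv> frechet_derivative (v 1 \<circ> \<phi>) (at u)"
    and "\<mu> \<equiv> signed_dist S v 1 j (\<phi> u)"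
  shows "Vfield A S v 1 j (\<phi> u) = F e"
    and "Efield A S v 1 j (\<phi> u) = F e - (F e \<bullet> v 1 (\<phi> u)) *\<^sub>R v 1 (\<phi> u)"
    and "Efield A S v 1 j (\<phi> u) = \<mu> *\<^sub>R N e"
    and "F y \<bullet> N e = \<mu> * (N e \<bullet> N y)"
    and "N e \<noteq> 0"
proof -
  have p: "\<phi> u \<in> S 1" by (rule immersed_chart(5)[OF submanifold[OF one_in] c])
  let ?\<nu> = "v 1 (\<phi> u)" and ?m = "frechet_derivative (signed_dist S v 1 j \<circ> \<phi>) (at u)"
  have vv: "?\<nu> \<bullet> ?\<nu> = 1" by (rule field_tangent(3)[OF one_in p])
  have Nv: "N y \<bullet> ?\<nu> = 0" for y unfolding N_def by (rule v_derivative_v[OF c])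
  have vN: "?\<nu> \<bullet> N y = 0" for y using Nv[of y] by (simp only: inner_commute)
  have T: "frechet_derivative (transfer S v 1 j \<circ> \<phi>) (at u) y = F y - (\<mu> *\<^sub>R N y + ?m y *\<^sub>R ?\<nu>)" for y
    unfolding F_def N_def \<mu>_def by (rule transfer_derivative_eq[OF c j])
  \<comment> \<open>The equation for \<open>e\<close>, solved for \<open>F e\<close>. Its part along
    \<open>v 1\<close> is exactly what \<open>Efield\<close> subtracts, so only the multiple of
    \<open>N e\<close> is left.\<close>
  have Fe: "F e = \<mu> *\<^sub>R N e + (1 + ?m e) *\<^sub>R ?\<nu>"
    using e unfolding T by (simp add: algebra_simps)
  show V: "Vfield A S v 1 j (\<phi> u) = F e"
    unfolding Vfield_def Let_def transfer_line(1)[OF one_in j p] e[symmetric] F_def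
    by (rule transfer_derivative(3)[OF c j])
  show E: "Efield A S v 1 j (\<phi> u) = F e - (F e \<bullet> ?\<nu>) *\<^sub>R ?\<nu>"
    unfolding Efield_def V ..
  have "F e \<bullet> ?\<nu> = 1 + ?m e" unfolding Fe by (simp add: inner_add_left Nv vv)
  then show "Efield A S v 1 j (\<phi> u) = \<mu> *\<^sub>R N e" unfolding E using Fe by simp
  have sym: "F x \<bullet> N y = F y \<bullet> N x" for x y
    unfolding F_def N_def by (rule derivative_symmetric[OF c])
  have "0 = (F e - (\<mu> *\<^sub>R N e + ?m e *\<^sub>R ?\<nu>)) \<bullet> N y" using e unfolding T by (simp add: vN)
  also have "\<dots> = F y \<bullet> N e - \<mu> * (N e \<bullet> N y)"
    by (simp add: inner_diff_left inner_add_left vN sym[of e y])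
  finally show "F y \<bullet> N e = \<mu> * (N e \<bullet> N y)" by simp
  \<comment> \<open>Otherwise \<open>F e\<close> would be a multiple of \<open>v 1\<close>, so
    \<open>line_derivative_injective\<close> would give \<open>e = 0\<close>, although the
    differential of the transfer sends \<open>e\<close> to a unit vector.\<close>
  show "N e \<noteq> 0"
  proof
    assume N0: "N e = 0"
    then have "F e = (1 + ?m e) *\<^sub>R ?\<nu>" using Fe by simp
    then have "e = 0" using line_derivative_injective[OF c] N0 unfolding F_def N_def by blast
    then have "?\<nu> = 0"
      using e linear_0[OF linear_frechet_derivative[OF C2_fun_differentiable[OF transfer_C2_fun[OF one_in j] c]]] by simp
    then show False using vv by simp
  qed
qed

text \<open>The chart coordinates of \<open>Vfield\<close> solve a linear system with injective C1
  coefficients, namely the differential of the transfer, and right-hand side \<open>v 1\<close>;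
  \<open>C1_on_solution\<close> makes them C1.\<close>

lemma Efield_C1:
  assumes j: "j \<in> {1..k}"
  shows "C1_fun (A 1) (Efield A S v 1 j)"
  unfolding C1_fun_def
proof (rule ballI, clarify)
  fix U \<phi> assume c: "(U, \<phi>) \<in> A 1"
  note A = submanifold[OF one_in]
  note oU = immersed_chart(1)[OF A c]
  let ?t = "transfer S v 1 j"
  have t: "C2_on U (?t \<circ> \<phi>)" using transfer_C2_fun[OF one_in j] c unfolding C2_fun_def by blast
  have v: "C1_on U (v 1 \<circ> \<phi>)" using v_C2[OF one_in] c C2_on_imp_C1_on unfolding C2_fun_def by blast
  have "\<forall>u\<in>U. \<exists>e. frechet_derivative (?t \<circ> \<phi>) (at u) e = (v 1 \<circ> \<phi>) u"
    using direction[OF c _ j] by (metis comp_apply)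
  then obtain e where e: "\<And>u. u \<in> U \<Longrightarrow> frechet_derivative (?t \<circ> \<phi>) (at u) (e u) = (v 1 \<circ> \<phi>) u" by metis
  have C1e: "C1_on U e"
  proof (rule C1_on_solution[where L = "\<lambda>x. frechet_derivative (?t \<circ> \<phi>) (at x)", OF oU _ _ _ v e])
    show "linear (frechet_derivative (?t \<circ> \<phi>) (at x))" if "x \<in> U" for x
      by (rule linear_frechet_derivative[OF C2_on_differentiable[OF t that]])
    show "inj (frechet_derivative (?t \<circ> \<phi>) (at x))" if "x \<in> U" for x
      by (rule transfer_derivative(1)[OF c that j])
    show "C1_on U (\<lambda>x. frechet_derivative (?t \<circ> \<phi>) (at x) b)" for b
      using C2_on_iff[OF oU] t by blast
  qed
  have "C1_on U (\<lambda>x. \<Sum>b\<in>Basis. (e x \<bullet> b) *\<^sub>R frechet_derivative \<phi> (at x) b)"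
    by (intro C1_on_sum C1_on_scaleR C1_on_inner C1e C1_on_const chart_derivative_C1[OF A c])
  then have V: "C1_on U (\<lambda>x. frechet_derivative \<phi> (at x) (e x))"
    by (rule C1_on_cong[OF oU, rotated]) (rule linear_eq_sum_Basis[OF chart_differentiable(2)[OF A c], symmetric])
  have "C1_on U (\<lambda>x. frechet_derivative \<phi> (at x) (e x) - (frechet_derivative \<phi> (at x) (e x) \<bullet> (v 1 \<circ> \<phi>) x) *\<^sub>R (v 1 \<circ> \<phi>) x)"
    by (rule C1_on_diff[OF V C1_on_scaleR[OF C1_on_inner[OF V v] v]])
  then show "C1_on U (Efield A S v 1 j \<circ> \<phi>)"
  proof (rule C1_on_cong[OF oU, rotated])
    fix x assume x: "x \<in> U"
    show "frechet_derivative \<phi> (at x) (e x) - (frechet_derivative \<phi> (at x) (e x) \<bullet> (v 1 \<circ> \<phi>) x) *\<^sub>R (v 1 \<circ> \<phi>) x = (Efield A S v 1 j \<circ> \<phi>) x"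
      using Efield_chart(2)[OF c x j, of "e x"] e[OF x] by simp
  qed
qed

section \<open>The principal frame of \<open>v 1\<close>\<close>

lemma Efield_pointwise:
  assumes p: "p \<in> S 1" and j: "j \<in> {2..k}"
  shows "Efield A S v 1 j p \<in> perp (A 1) (v 1) p"
    and "Efield A S v 1 j p \<noteq> 0"
    and "i \<in> {2..k} \<Longrightarrow> i \<noteq> j \<Longrightarrow> Efield A S v 1 i p \<bullet> Efield A S v 1 j p = 0"
    and "X \<in> tangent_space (A 1) p \<Longrightarrow>
      mderiv (A 1) (v 1) p X \<bullet> Efield A S v 1 j p = 1 / signed_dist S v 1 j p * (X \<bullet> Efield A S v 1 j p)"
proof -
  note A = submanifold[OF one_in]
  have j1: "j \<in> {1..k}" "j \<noteq> 1" using j by auto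
  obtain U \<phi> u where c: "(U, \<phi>) \<in> A 1" "u \<in> U" and up: "\<phi> u = p" using immersed_chart_exists[OF A p] .
  obtain e where e: "frechet_derivative (transfer S v 1 j \<circ> \<phi>) (at u) e = v 1 (\<phi> u)" using direction[OF c j1(1)] .
  let ?F = "frechet_derivative \<phi> (at u)" and ?N = "frechet_derivative (v 1 \<circ> \<phi>) (at u)"
  let ?\<mu> = "\<lambda>j. signed_dist S v 1 j p"
  note E = Efield_chart[OF c j1(1) e, unfolded up]
  have mu: "?\<mu> j \<noteq> 0" using nonzero[OF one_in j1(1) j1(2)[symmetric] p] .
  have "?F e \<in> tangent_space (A 1) p" using tangent_space_chart[OF A c] up by auto
  then have "Efield A S v 1 j p \<in> tangent_space (A 1) p"
    unfolding E(2) using subspace_tangent_space[OF A p] field_tangent(1)[OF one_in p]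
    by (intro subspace_diff subspace_scale)
  moreover have "Efield A S v 1 j p \<bullet> v 1 p = 0"
    unfolding E(3) using v_derivative_v[OF c, of e] up by simp
  ultimately show "Efield A S v 1 j p \<in> perp (A 1) (v 1) p" unfolding perp_def by blast
  show "Efield A S v 1 j p \<noteq> 0" unfolding E(3) using mu E(5) by simp
  show "Efield A S v 1 i p \<bullet> Efield A S v 1 j p = 0" if i: "i \<in> {2..k}" "i \<noteq> j"
  proof -
    have i1: "i \<in> {1..k}" using i by auto
    obtain e' where e': "frechet_derivative (transfer S v 1 i \<circ> \<phi>) (at u) e' = v 1 (\<phi> u)" using direction[OF c i1] .
    note E' = Efield_chart[OF c i1 e', unfolded up]
    have "?F e' \<bullet> ?N e = ?\<mu> j * (?N e \<bullet> ?N e')" by (rule E(4))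
    moreover have "?F e \<bullet> ?N e' = ?\<mu> i * (?N e' \<bullet> ?N e)" by (rule E'(4))
    moreover have "?F e' \<bullet> ?N e = ?F e \<bullet> ?N e'" by (rule derivative_symmetric[OF c])
    ultimately have "?\<mu> j * (?N e' \<bullet> ?N e) = ?\<mu> i * (?N e' \<bullet> ?N e)"
      unfolding inner_commute[of "?N e" "?N e'"] by metis
    then have "?N e' \<bullet> ?N e = 0" using signed_dist_distinct[OF one_in i1 j1(1) i(2) p] by simp
    then show ?thesis unfolding E(3) E'(3) by simp
  qed
  show "mderiv (A 1) (v 1) p X \<bullet> Efield A S v 1 j p = 1 / ?\<mu> j * (X \<bullet> Efield A S v 1 j p)"
    if X: "X \<in> tangent_space (A 1) p"
  proof -
    obtain x where x: "X = ?F x" using X tangent_space_chart[OF A c] up by auto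
    have "mderiv (A 1) (v 1) p X = ?N x"
      using mderiv_chart[OF A c C2_fun_differentiable[OF v_C2[OF one_in] c], of x] x up by simp
    then show ?thesis
      unfolding E(3) x using E(4)[of x] mu by (simp add: inner_commute)
  qed
qed

lemma orthogonal_frame_Efield:
  "orthogonal_frame (A 1) (S 1) (perp (A 1) (v 1)) {2..k} (Efield A S v 1)"
proof -
  note A = submanifold[OF one_in]
  have C1: "C1_fun (A 1) (Efield A S v 1 j)" if "j \<in> {2..k}" for j
    by (rule Efield_C1) (use that in auto)
  have "(\<forall>i\<in>{2..k}. \<forall>j\<in>{2..k}. i \<noteq> j \<longrightarrow> Efield A S v 1 i p \<bullet> Efield A S v 1 j p = 0) \<and>
      inj_on (\<lambda>j. Efield A S v 1 j p) {2..k} \<and> independent ((\<lambda>j. Efield A S v 1 j p) ` {2..k}) \<and>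
      span ((\<lambda>j. Efield A S v 1 j p) ` {2..k}) = perp (A 1) (v 1) p" if p: "p \<in> S 1" for p
  proof -
    let ?E = "\<lambda>j. Efield A S v 1 j p" and ?P = "perp (A 1) (v 1) p" and ?T = "tangent_space (A 1) p"
    have orth: "?E i \<bullet> ?E j = 0" if "i \<in> {2..k}" "j \<in> {2..k}" "i \<noteq> j" for i j
      by (rule Efield_pointwise(3)[OF p that(2,1,3)])
    have inj: "inj_on ?E {2..k}"
    proof (rule inj_onI, rule ccontr)
      fix i j assume ij: "i \<in> {2..k}" "j \<in> {2..k}" "?E i = ?E j" "i \<noteq> j"
      then have "?E j \<bullet> ?E j = 0" using orth[OF ij(1,2,4)] by simp
      then show False using Efield_pointwise(2)[OF p ij(2)] by simp
    qed
    have "pairwise orthogonal (?E ` {2..k})"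
      unfolding pairwise_def orthogonal_def using orth by force
    then have ind: "independent (?E ` {2..k})"
      by (rule pairwise_orthogonal_independent) (use Efield_pointwise(2)[OF p] in force)
    note sT = subspace_tangent_space[OF A p]
    have sP: "subspace ?P"
      unfolding perp_def using sT by (auto simp: subspace_def inner_add_left)
    have span: "span (?E ` {2..k}) = ?P"
    proof (rule subspace_dim_equal[OF subspace_span sP])
      show "span (?E ` {2..k}) \<subseteq> ?P"
        by (rule span_minimal[OF _ sP]) (use Efield_pointwise(1)[OF p] in blast)
      \<comment> \<open>\<open>v 1 p\<close> is tangent but not orthogonal to itself, so
        \<open>?P\<close> has dimension at most \<open>k - 1\<close>, which is the number of indices
        in \<open>{2..k}\<close>.\<close>
      have "?P \<subseteq> ?T" "v 1 p \<notin> ?P" "v 1 p \<in> ?T"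
        unfolding perp_def using field_tangent[OF one_in p] by auto
      then have "?P \<subset> ?T" by blast
      then have "dim ?P < dim ?T"
        by (intro dim_psubset) (simp only: span_eq_iff[THEN iffD2, OF sP] span_eq_iff[THEN iffD2, OF sT])
      then have "dim ?P \<le> k - 1" unfolding dim_tangent_space[OF A p] dim by simp
      also have "\<dots> = dim (span (?E ` {2..k}))"
        unfolding dim_span dim_eq_card_independent[OF ind] card_image[OF inj] by simp
      finally show "dim ?P \<le> dim (span (?E ` {2..k}))" .
    qed
    show ?thesis using orth inj ind span by simp
  qed
  with C1 show ?thesis unfolding orthogonal_frame_def by simp
qed

lemma inverse_signed_dist_derivative:
  assumes c: "(U, \<phi>) \<in> A 1" "u \<in> U" and j: "j \<in> {2..k}"
  shows "(((\<lambda>p. 1 / signed_dist S v 1 j p) \<circ> \<phi>) has_derivative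
    (\<lambda>x. - frechet_derivative (signed_dist S v 1 j \<circ> \<phi>) (at u) x / (signed_dist S v 1 j (\<phi> u))\<^sup>2)) (at u)"
proof -
  have j1: "j \<in> {1..k}" "1 \<noteq> j" using j by auto
  have mu: "(signed_dist S v 1 j \<circ> \<phi>) u \<noteq> 0"
    using nonzero[OF one_in j1 immersed_chart(5)[OF submanifold[OF one_in] c]] by simp
  show ?thesis
    using has_derivative_divide'[OF has_derivative_const[of 1] has_derivative_frechet_derivative[OF signed_dist_differentiable[OF c j1(1)]] mu]
    by (simp add: o_def power2_eq_square)
qed

text \<open>Makes the curvature formulas available on \<open>S 1\<close>, with the reciprocal signed
  distances as eigenvalues.\<close>

sublocale principal_frame "A 1" "S 1" "v 1" "{2..k}" "Efield A S v 1" "\<lambda>j p. 1 / signed_dist S v 1 j p"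
proof
  show "immersed_submanifold (A 1) (S 1)" by (rule submanifold[OF one_in])
  show "unit_vector_field (A 1) (S 1) (v 1)" by (rule unit_field[OF one_in])
  show "orthogonal_frame (A 1) (S 1) (perp (A 1) (v 1)) {2..k} (Efield A S v 1)"
    by (rule orthogonal_frame_Efield)
  show "((\<lambda>p. 1 / signed_dist S v 1 j p) \<circ> \<phi>) differentiable at u"
    if "j \<in> {2..k}" "(U, \<phi>) \<in> A 1" "u \<in> U" for j U \<phi> u
    by (rule differentiableI[OF inverse_signed_dist_derivative[OF that(2,3,1)]])
  show "mderiv (A 1) (v 1) p X \<bullet> Efield A S v 1 j p = 1 / signed_dist S v 1 j p * (X \<bullet> Efield A S v 1 j p)"
    if "j \<in> {2..k}" "p \<in> S 1" "X \<in> tangent_space (A 1) p" for j p X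
    by (rule Efield_pointwise(4)[OF that(2,1,3)])
qed simp

text \<open>In the Riccati expression with eigenvalue 1/\<mu>, the derivative contributes d\<mu>(v)
  over the square of \<mu>, and the square of the eigenvalue is the origin of the \<open>- 1\<close>
  in the numerator.\<close>

lemma sectional_curvature_Efield:
  assumes p: "p \<in> S 1" and j: "j \<in> {2..k}"
  shows "sectional_curvature (A 1) (v 1) (Efield A S v 1 j) p
    = (mderiv (A 1) (signed_dist S v 1 j) p (v 1 p) - 1) / (signed_dist S v 1 j p)\<^sup>2"
proof -
  note A = submanifold[OF one_in]
  have j1: "j \<in> {1..k}" using j by auto
  obtain U \<phi> u where c: "(U, \<phi>) \<in> A 1" "u \<in> U" and up: "\<phi> u = p" using immersed_chart_exists[OF A p] .
  obtain x where x: "v 1 p = frechet_derivative \<phi> (at u) x"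
    using field_tangent(1)[OF one_in p] tangent_space_chart[OF A c] up by auto
  note d = inverse_signed_dist_derivative[OF c j]
  have "mderiv (A 1) (\<lambda>p. 1 / signed_dist S v 1 j p) p (v 1 p) =
      - frechet_derivative (signed_dist S v 1 j \<circ> \<phi>) (at u) x / (signed_dist S v 1 j p)\<^sup>2"
    using mderiv_chart[OF A c differentiableI[OF d], of x] unfolding frechet_derivative_eqI[OF d] up x .
  moreover have "mderiv (A 1) (signed_dist S v 1 j) p (v 1 p) = frechet_derivative (signed_dist S v 1 j \<circ> \<phi>) (at u) x"
    using mderiv_chart[OF A c signed_dist_differentiable[OF c j1], of x] unfolding up x .
  ultimately show ?thesis
    unfolding sectional_curvature_frame[OF j p] by (simp add: power_divide diff_divide_distrib)
qed

text \<open>The shape operator is computed from the connection of \<open>S 1\<close>, so the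
  integral manifold enters through its points and tangent spaces alone.\<close>

lemma principal_direction_Efield:
  assumes C: "integral_manifold C M (A 1) (S 1) (perp (A 1) (v 1))" and p: "p \<in> M" and j: "j \<in> {2..k}"
  shows "principal_direction C (A 1) (v 1) p (Efield A S v 1 j p) (1 / signed_dist S v 1 j p)"
proof -
  have p1: "p \<in> S 1" and T: "tangent_space C p = perp (A 1) (v 1) p"
    using C p unfolding integral_manifold_def by blast+
  show ?thesis
    unfolding principal_direction_def T
    using Efield_pointwise(1,2)[OF p1 j] shape_operator_frame[OF j p1] by blast
qed

lemma inj_on_inverse_signed_dist:
  assumes p: "p \<in> S 1"
  shows "inj_on (\<lambda>j. 1 / signed_dist S v 1 j p) {2..k}"
proof (rule inj_onI, rule ccontr)
  fix i j assume ij: "i \<in> {2..k}" "j \<in> {2..k}" "1 / signed_dist S v 1 i p = 1 / signed_dist S v 1 j p" "i \<noteq> j"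
  then have "signed_dist S v 1 i p = signed_dist S v 1 j p" by simp
  moreover have "i \<in> {1..k}" "j \<in> {1..k}" using ij by auto
  ultimately show False using signed_dist_distinct[OF one_in _ _ ij(4) p] by blast
qed

end

theorem theorem3:
  fixes k :: nat
    and S :: "nat \<Rightarrow> 'a::euclidean_space set"
    and A :: "nat \<Rightarrow> ('b::euclidean_space, 'a) atlas"
    and v :: "nat \<Rightarrow> 'a \<Rightarrow> 'a"
    and \<Gamma> :: "('a \<times> 'a) set"
    and G :: "('b, 'a \<times> 'a) atlas"
  assumes dim: "DIM('b) = k"
    and submanifold: "\<And>i. i \<in> {1..k} \<Longrightarrow> immersed_submanifold (A i) (S i)"
    and unit_field: "\<And>i. i \<in> {1..k} \<Longrightarrow> unit_vector_field (A i) (S i) (v i)"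
    and lines: "immersed_submanifold G \<Gamma>"
    and image: "\<And>i. i \<in> {1..k} \<Longrightarrow> Phi (v i) ` S i = \<Gamma>"
    and diffeo: "\<And>i. i \<in> {1..k} \<Longrightarrow> diffeomorphism (A i) (S i) G \<Gamma> (Phi (v i))"
    and isotropic: "isotropic G \<Gamma>"
    and nonzero: "\<And>i j q. i \<in> {1..k} \<Longrightarrow> j \<in> {1..k} \<Longrightarrow> i \<noteq> j \<Longrightarrow> q \<in> S i \<Longrightarrow>
                    signed_dist S v i j q \<noteq> 0"
  shows "(\<forall>(C :: ('c::euclidean_space, 'a) atlas) M.
            integral_manifold C M (A 1) (S 1) (perp (A 1) (v 1)) \<longrightarrow>
            (\<forall>p\<in>M.
               (\<forall>j\<in>{2..k}. principal_direction C (A 1) (v 1) p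
                              (Efield A S v 1 j p) (1 / signed_dist S v 1 j p)) \<and>
               inj_on (\<lambda>j. 1 / signed_dist S v 1 j p) {2..k})) \<and>
         orthogonal_frame (A 1) (S 1) (perp (A 1) (v 1)) {2..k} (Efield A S v 1) \<and>
         (\<forall>p\<in>S 1.
            ricci (A 1) (v 1) (v 1) p
              = (\<Sum>j=2..k. sectional_curvature (A 1) (v 1) (Efield A S v 1 j) p) \<and>
            (\<Sum>j=2..k. sectional_curvature (A 1) (v 1) (Efield A S v 1 j) p)
              = (\<Sum>j=2..k. (mderiv (A 1) (signed_dist S v 1 j) p (v 1 p) - 1)
                              / (signed_dist S v 1 j p)\<^sup>2))"
proof -
  interpret common_lines k S A v \<Gamma> G
    by unfold_locales (fact dim submanifold unit_field lines diffeo isotropic nonzero)+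
  have S1: "p \<in> S 1" if "integral_manifold C M (A 1) (S 1) (perp (A 1) (v 1))" "p \<in> M"
    for C :: "('c, 'a) atlas" and M p
    using that unfolding integral_manifold_def by blast
  show ?thesis
  proof (intro conjI allI impI ballI)
    fix C :: "('c, 'a) atlas" and M p
    assume C: "integral_manifold C M (A 1) (S 1) (perp (A 1) (v 1))" "p \<in> M"
    show "principal_direction C (A 1) (v 1) p (Efield A S v 1 j p) (1 / signed_dist S v 1 j p)"
      if "j \<in> {2..k}" for j
      by (rule principal_direction_Efield[OF C that])
    show "inj_on (\<lambda>j. 1 / signed_dist S v 1 j p) {2..k}"
      by (rule inj_on_inverse_signed_dist[OF S1[OF C]])
  next
    show "orthogonal_frame (A 1) (S 1) (perp (A 1) (v 1)) {2..k} (Efield A S v 1)"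
      by (rule orthogonal_frame_Efield)
  next
    fix p assume p: "p \<in> S 1"
    show "ricci (A 1) (v 1) (v 1) p = (\<Sum>j=2..k. sectional_curvature (A 1) (v 1) (Efield A S v 1 j) p)"
      by (rule ricci_frame[OF p])
    show "(\<Sum>j=2..k. sectional_curvature (A 1) (v 1) (Efield A S v 1 j) p)
      = (\<Sum>j=2..k. (mderiv (A 1) (signed_dist S v 1 j) p (v 1 p) - 1) / (signed_dist S v 1 j p)\<^sup>2)"
      by (rule sum.cong[OF refl]) (rule sectional_curvature_Efield[OF p])
  qed
qed

end
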